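(* Let $n\in\mathbb{N}^+$ and let $h$ be a left-continuous gauge function. Let $K$ be a compact metric space such that $\dim_T U\geq n$ and $\mathcal{P}^h(U)=\infty$ for all non-empty open sets $U\subset K$. Then for a generic $f\in C(K,\mathbb{R}^n)$, for all $y\in\operatorname{int}f(K)$ we have \[\mathcal{P}^h(f^{-1}(y))=\infty.\] Moreover, the measures $\mathcal{P}^h|_{f^{-1}(y)}$ are not $\sigma$-finite.
   Context: $\dim_T$ is the topological dimension (small inductive dimension: $\dim_T\emptyset=-1$ and $\dim_T X=\inf\{d: X$ has a basis $\mathcal{U}$ with $\dim_T\partial U\leq d-1$ for all $U\in\mathcal{U}\}$). A gauge function is a non-decreasing function $h\colon[0,\infty)\to[0,\infty)$. For a metric space $X$ and $A\subset X$, a $\delta$-packing of $A$ is a countable collection of disjoint closed balls $\{B(x_i,r_i)\}_{i\geq1}$ with centers $x_i\in A$ and radii $0\leq r_i\leq\delta$, where $B(x,r)=\{y\in X:\rho(x,y)\leq r\}$. Let $P^h_\delta(A)=\sup\{\sum_i h(r_i):\{B(x_i,r_i)\}$ is a $\delta$-packing of $A\}$, $P^h_0(A)=\lim_{\delta\to0+}P^h_\delta(A)$ for non-empty $A$, $P^h_0(\emptyset)=0$, and define the $h$-packing measure $\mathcal{P}^h(A)=\inf\{\sum_{i=1}^\infty P^h_0(A_i):A=\bigcup_{i=1}^\infty A_i\}$. $C(K,\mathbb{R}^n)$ is the complete metric space of continuous maps $K\to\mathbb{R}^n$ with the maximum norm. A property holds for a generic $f\in C(K,\mathbb{R}^n)$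 if the set of $f$ having it is co-meager. $\operatorname{int}f(K)$ is the interior of $f(K)$ in $\mathbb{R}^n$. The "Moreover" part refers to the same generic $f$ and all $y\in\operatorname{int}f(K)$. *)

theory Defs
  imports "HOL-Analysis.Analysis"
begin

section \<open>Small inductive dimension\<close>

text \<open>
  The library provides the relation \<open>X dim_le d\<close>; the number it determines is its least
  integer bound, \<open>\<infinity>\<close> if there is none. The two lemmas below confirm the recursive
  characterisation by bases whose members have boundaries of smaller dimension.
\<close>

definition small_ind_dim :: "'a topology \<Rightarrow> ereal" where
  "small_ind_dim X = Inf {ereal (real_of_int d) | d. X dim_le d}"

lemma small_ind_dim_le_iff:
  "small_ind_dim X \<le> ereal (real_of_int d) \<longleftrightarrow> X dim_le d"
proof
  assume le: "small_ind_dim X \<le> ereal (real_of_int d)"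
  show "X dim_le d"
  proof (rule ccontr)
    assume n: "\<not> X dim_le d"
    have "ereal (real_of_int (d + 1)) \<le> small_ind_dim X"
      unfolding small_ind_dim_def
    proof (rule Inf_greatest, clarify)
      fix e assume "X dim_le e"
      then have "\<not> e \<le> d" using n dimension_le_mono by blast
      then show "ereal (real_of_int (d + 1)) \<le> ereal (real_of_int e)" by simp
    qed
    from order_trans[OF this le] show False by simp
  qed
qed (auto simp: small_ind_dim_def intro: Inf_lower)

lemma small_ind_dim_empty:
  assumes "topspace X = {}" shows "small_ind_dim X = -1"
proof -
  have X: "X = trivial_topology" using assms by simp
  have "X dim_le d \<longleftrightarrow> -1 \<le> d" for d
    using X dimension_le_bound dimension_le_eq_empty dimension_le_mono by blast
  then have "small_ind_dim X = Inf {ereal (real_of_int d) | d. -1 \<le> d}"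
    by (simp add: small_ind_dim_def)
  also have "\<dots> = -1"
  proof (rule antisym)
    show "Inf {ereal (real_of_int d) | d. -1 \<le> d} \<le> -1"
      by (rule Inf_lower) (auto intro!: exI[of _ "-1"] simp: one_ereal_def)
    show "-1 \<le> Inf {ereal (real_of_int d) | d. -1 \<le> d}"
    proof (rule Inf_greatest, clarify)
      fix d :: int assume "-1 \<le> d"
      then have "-1 \<le> real_of_int d" by linarith
      then show "-1 \<le> ereal (real_of_int d)"
        by (simp add: one_ereal_def)
    qed
  qed
  finally show ?thesis .
qed

lemma small_ind_dim_rec:
  assumes "topspace X \<noteq> {}"
  shows "small_ind_dim X = Inf {ereal (real_of_int d) | d. \<exists>\<B>.
    (\<forall>U\<in>\<B>. openin X U) \<and> (\<forall>V. openin X V \<longrightarrow> (\<exists>\<U>\<subseteq>\<B>. \<Union>\<U> = V)) \<and>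
    (\<forall>U\<in>\<B>. small_ind_dim (subtopology X (X frontier_of U)) \<le> ereal (real_of_int (d - 1)))}"
proof -
  have "X dim_le d \<longleftrightarrow> (\<exists>\<B>.
    (\<forall>U\<in>\<B>. openin X U) \<and> (\<forall>V. openin X V \<longrightarrow> (\<exists>\<U>\<subseteq>\<B>. \<Union>\<U> = V)) \<and>
    (\<forall>U\<in>\<B>. subtopology X (X frontier_of U) dim_le (d - 1)))" (is "?L \<longleftrightarrow> ?R") for d
  proof
    assume L: ?L
    let ?B = "{U. openin X U \<and> subtopology X (X frontier_of U) dim_le (d - 1)}"
    have "\<exists>\<U>\<subseteq>?B. \<Union>\<U> = V" if V: "openin X V" for V
    proof (intro exI conjI)
      show "{U\<in>?B. U \<subseteq> V} \<subseteq> ?B" by blast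
      show "\<Union>{U\<in>?B. U \<subseteq> V} = V"
        using L V unfolding dimension_le.simps[of X d] by blast
    qed
    then show ?R by (intro exI[of _ ?B]) blast
  next
    assume ?R
    then obtain \<B> where op: "\<forall>U\<in>\<B>. openin X U"
      and base: "\<forall>V. openin X V \<longrightarrow> (\<exists>\<U>\<subseteq>\<B>. \<Union>\<U> = V)"
      and fr: "\<forall>U\<in>\<B>. subtopology X (X frontier_of U) dim_le (d - 1)"
      by (elim exE conjE)
    have nbhd: "\<exists>U\<in>\<B>. a \<in> U \<and> U \<subseteq> V" if V: "openin X V" "a \<in> V" for V a
    proof -
      obtain \<U> where "\<U> \<subseteq> \<B>" "\<Union>\<U> = V" using base V(1) by meson
      then show ?thesis using V(2) by auto
    qed
    obtain a where "a \<in> topspace X" using assms by blast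
    then obtain U where "U \<in> \<B>" using nbhd[OF openin_topspace] by auto
    then have "-1 \<le> d" using fr dimension_le_bound by force
    moreover have "\<exists>U. a \<in> U \<and> U \<subseteq> V \<and> openin X U \<and>
        subtopology X (X frontier_of U) dim_le (d - 1)" if "openin X V" "a \<in> V" for V a
      using nbhd[OF that] op fr by meson
    ultimately show ?L by (rule dimension_le.intros)
  qed
  then show ?thesis
    by (subst small_ind_dim_def) (simp only: small_ind_dim_le_iff)
qed


section \<open>Packing measures\<close>

definition gauge_function :: "(real \<Rightarrow> real) \<Rightarrow> bool" where
  "gauge_function h \<longleftrightarrow> mono_on {0..} h \<and> (\<forall>r\<ge>0. 0 \<le> h r)"

text \<open>
  A packing is encoded as its set of (centre, radius) pairs. Since a closed ball contains its
  centre, distinct members of a disjoint family of balls have distinct pairs.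
\<close>

definition packings :: "real \<Rightarrow> 'a::metric_space set \<Rightarrow> ('a \<times> real) set set" where
  "packings \<delta> A = {S. countable S \<and> S \<subseteq> A \<times> {0..\<delta>} \<and>
                      disjoint_family_on (\<lambda>(x, r). cball x r) S}"

definition packing_delta :: "(real \<Rightarrow> real) \<Rightarrow> real \<Rightarrow> 'a::metric_space set \<Rightarrow> ennreal" where
  "packing_delta h \<delta> A = (SUP S\<in>packings \<delta> A. \<Sum>\<^sub>\<infinity>(x, r)\<in>S. ennreal (h r))"

definition packing_premeasure :: "(real \<Rightarrow> real) \<Rightarrow> 'a::metric_space set \<Rightarrow> ennreal" where
  "packing_premeasure h A =
     (if A = {} then 0 else Lim (at_right 0) (\<lambda>\<delta>. packing_delta h \<delta> A))"

definition packing_measure :: "(real \<Rightarrow> real) \<Rightarrow> 'a::metric_space set \<Rightarrow> ennreal" where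
  "packing_measure h A =
     (INF B\<in>{B :: nat \<Rightarrow> 'a set. A = (\<Union>i. B i)}. \<Sum>i. packing_premeasure h (B i))"

text \<open>
  \<open>packing_measure h\<close> is an outer measure. Its restriction to (the subsets of) a set \<open>A\<close> becomes
  a measure on the sigma-algebra of the subsets of \<open>A\<close> that are measurable in the sense of
  Caratheodory. The lemmas after the definition show that the arguments of \<open>measure_of\<close> do form a
  measure space, so that the definition never degenerates to the null measure.
\<close>

definition packing_measure_on :: "(real \<Rightarrow> real) \<Rightarrow> 'a::metric_space set \<Rightarrow> 'a measure" where
  "packing_measure_on h A =
     measure_of A (lambda_system A (Pow A) (packing_measure h)) (packing_measure h)"

lemma packing_delta_mono:
  assumes "\<delta> \<le> \<epsilon>" "A \<subseteq> B"
  shows "packing_delta h \<delta> A \<le> packing_delta h \<epsilon> B"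
proof -
  have "packings \<delta> A \<subseteq> packings \<epsilon> B"
    using assms by (fastforce simp: packings_def)
  then show ?thesis unfolding packing_delta_def by (rule SUP_subset_mono) simp
qed

lemma packing_delta_tendsto:
  "((\<lambda>\<delta>. packing_delta h \<delta> A) \<longlongrightarrow> (INF \<delta>\<in>{0<..}. packing_delta h \<delta> A)) (at_right 0)"
proof (rule order_tendstoI)
  fix a assume a: "a < (INF \<delta>\<in>{0<..}. packing_delta h \<delta> A)"
  show "\<forall>\<^sub>F \<delta> in at_right 0. a < packing_delta h \<delta> A"
    using eventually_at_right_less[of 0]
    by eventually_elim (use a in \<open>auto intro: less_le_trans INF_lower\<close>)
next
  fix a assume "(INF \<delta>\<in>{0<..}. packing_delta h \<delta> A) < a"
  then obtain e where e: "0 < e" "packing_delta h e A < a" by (auto simp: INF_less_iff)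
  show "\<forall>\<^sub>F \<delta> in at_right 0. packing_delta h \<delta> A < a"
    using eventually_at_right_real[OF e(1)]
    by eventually_elim
       (meson e(2) greaterThanLessThan_iff le_less_trans less_imp_le order_refl packing_delta_mono)
qed

lemma packing_premeasure_eq_INF:
  "packing_premeasure h A = (INF \<delta>\<in>{0<..}. packing_delta h \<delta> A)"
proof (cases "A = {}")
  case True
  have "packings \<delta> ({} :: 'a set) = {{}}" for \<delta> :: real
    by (auto simp: packings_def disjoint_family_on_def)
  then have "packing_delta h \<delta> A = 0" for \<delta>
    using True by (simp add: packing_delta_def)
  then show ?thesis using True by (simp add: packing_premeasure_def)
next
  case False
  then show ?thesis
    using tendsto_Lim[OF _ packing_delta_tendsto[of h A]] by (simp add: packing_premeasure_def)
qed

lemma packing_premeasure_mono: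
  "A \<subseteq> B \<Longrightarrow> packing_premeasure h A \<le> packing_premeasure h B"
  unfolding packing_premeasure_eq_INF by (rule INF_mono) (auto intro: packing_delta_mono)

lemma packing_measure_eq_outer_measure:
  "packing_measure h = outer_measure UNIV (packing_premeasure h)"
proof (rule ext, rule antisym)
  interpret ring_of_sets UNIV "UNIV :: 'a set set" using ring_of_sets_Pow[of UNIV] by simp
  have pos: "positive UNIV (packing_premeasure h :: 'a set \<Rightarrow> _)"
    by (simp add: positive_def packing_premeasure_def)
  have inc: "increasing UNIV (packing_premeasure h :: 'a set \<Rightarrow> _)"
    by (simp add: increasing_def packing_premeasure_mono)
  fix A :: "'a set"
  show "packing_measure h A \<le> outer_measure UNIV (packing_premeasure h) A"
    unfolding outer_measure_def
  proof (rule INF_greatest, clarify)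
    fix B :: "nat \<Rightarrow> 'a set" assume "A \<subseteq> (\<Union>i. B i)"
    then have "packing_measure h A \<le> (\<Sum>i. packing_premeasure h (B i \<inter> A))"
      unfolding packing_measure_def by (intro INF_lower) auto
    also have "\<dots> \<le> (\<Sum>i. packing_premeasure h (B i))"
      by (intro suminf_le packing_premeasure_mono) auto
    finally show "packing_measure h A \<le> (\<Sum>i. packing_premeasure h (B i))" .
  qed
  show "outer_measure UNIV (packing_premeasure h) A \<le> packing_measure h A"
    unfolding packing_measure_def
    by (rule INF_greatest) (auto intro!: outer_measure_le[OF pos inc])
qed

lemma outer_measure_space_packing_measure:
  "outer_measure_space (Pow A) (packing_measure h)"
proof -
  interpret ring_of_sets UNIV "UNIV :: 'a set set" using ring_of_sets_Pow[of UNIV] by simp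
  have "outer_measure_space (Pow UNIV) (packing_measure h :: 'a set \<Rightarrow> _)"
    unfolding packing_measure_eq_outer_measure
    by (rule outer_measure_space_outer_measure)
       (simp_all add: positive_def increasing_def packing_premeasure_mono,
        simp add: packing_premeasure_def)
  then show ?thesis
    by (auto simp: outer_measure_space_def positive_def increasing_def countably_subadditive_def)
qed

lemma
  shows space_packing_measure_on: "space (packing_measure_on h A) = A"
    and sets_packing_measure_on:
      "sets (packing_measure_on h A) = lambda_system A (Pow A) (packing_measure h)"
    and emeasure_packing_measure_on:
      "E \<in> sets (packing_measure_on h A) \<Longrightarrow>
         emeasure (packing_measure_on h A) E = packing_measure h E"
proof -
  let ?L = "lambda_system A (Pow A) (packing_measure h)"
  have ms: "measure_space A ?L (packing_measure h)"
    by (rule sigma_algebra.caratheodory_lemma[OF sigma_algebra_Pow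
          outer_measure_space_packing_measure])
  then interpret L: sigma_algebra A ?L by (simp add: measure_space_def)
  show "space (packing_measure_on h A) = A"
    unfolding packing_measure_on_def by (rule L.space_measure_of_eq)
  show s: "sets (packing_measure_on h A) = ?L"
    unfolding packing_measure_on_def by (rule L.sets_measure_of_eq)
  show "E \<in> sets (packing_measure_on h A) \<Longrightarrow>
         emeasure (packing_measure_on h A) E = packing_measure h E"
    using ms unfolding s packing_measure_on_def measure_space_def
    by (intro emeasure_measure_of_sigma) auto
qed


section \<open>Baire category\<close>

definition nowhere_dense :: "'a::topological_space set \<Rightarrow> bool" where
  "nowhere_dense S \<longleftrightarrow> interior (closure S) = {}"

definition meager :: "'a::topological_space set \<Rightarrow> bool" where
  "meager S \<longleftrightarrow> (\<exists>N :: nat \<Rightarrow> 'a set. (\<forall>i. nowhere_dense (N i)) \<and> S = (\<Union>i. N i))"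

definition comeager :: "'a::topological_space set \<Rightarrow> bool" where
  "comeager S \<longleftrightarrow> meager (- S)"

end

theory Submission
  imports Defs
begin

text \<open>
  Call \<open>y\<close> a stable value of \<open>f\<close> on \<open>A\<close> if every map uniformly close to \<open>f\<close> on \<open>A\<close> attains \<open>y\<close>
  on \<open>A\<close>. For fixed \<open>V\<close> the condition \<open>V \<subseteq> f(K)\<close> is closed, so its frontier is nowhere dense, and
  therefore every interior value of a generic \<open>f\<close> is stable on \<open>K\<close>.

  On every non-empty open set some map stably covers a ball of prescribed radius: otherwise all
  \<open>n\<close>-tuples of functions on a small closed ball could be perturbed to have no common zero, and then,
  inductively, generic level sets \<open>{u = 0}\<close> separate points from closed sets and admit no stable
  \<open>(n - 1)\<close>-tuples, which bounds the small inductive dimension by \<open>n - 1\<close>. Hence, after a small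
  perturbation of \<open>f\<^sub>0\<close>, near every \<open>x\<close> the value \<open>f\<^sub>0(x)\<close> becomes stable on tiny balls around all
  centres of a finite packing with large \<open>h\<close>-sum, and this persists in an open set of maps.

  For a generic \<open>f\<close>, let \<open>F\<close> be the closed set of points on all of whose neighbourhoods \<open>y\<close> is stable.
  By compactness \<open>F\<close> meets a neighbourhood of every set on which \<open>y\<close> is stable, so all non-empty
  relatively open subsets of \<open>F\<close> have infinite packing premeasure. Since the premeasure does not
  change under closure, Baire's theorem in \<open>F\<close> prevents \<open>f\<^sup>-\<^sup>1(y)\<close> from being covered by countably many
  sets of finite packing measure.
\<close>

section \<open>Approximation of continuous functions\<close>

lemma Baire_dense_open:
  fixes G :: "'a::complete_space set set"
  assumes "countable G" "\<And>T. T \<in> G \<Longrightarrow> open T" "\<And>T. T \<in> G \<Longrightarrow> closure T = UNIV"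
  shows "closure (\<Inter>G) = UNIV"
  using Baire_category[of "euclidean :: 'a topology" G] assms
  by (auto simp: completely_metrizable_space_euclidean)

lemma dense_approx:
  fixes S :: "'a::metric_space set"
  shows "closure S = UNIV \<longleftrightarrow> (\<forall>x e. 0 < e \<longrightarrow> (\<exists>y\<in>S. dist y x < e))"
  using closure_approachable[of _ S] by blast

lemma bcontfun_of_compact:
  fixes f :: "'a::metric_space \<Rightarrow> 'b::metric_space"
  assumes "compact (UNIV :: 'a set)" "continuous_on UNIV f"
  shows "apply_bcontfun (Bcontfun f) = f"
  using assms compact_continuous_image compact_imp_bounded
  by (intro Bcontfun_inverse) (auto simp: bcontfun_def)

text \<open>A finite net of mesh \<open>1 / (N + 1)\<close> carries tent functions \<open>p\<close>
  with positive sum. The weighted averages of rational values at net points form a countable family,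
  and uniform continuity makes it dense, since only net points close to \<open>x\<close> have
  non-zero weight at \<open>x\<close>.\<close>

lemma dense_countable_real_functions:
  assumes K: "compact (UNIV :: 'a::metric_space set)"
  obtains D :: "('a::metric_space \<Rightarrow> real) set" where "countable D" "\<And>d. d \<in> D \<Longrightarrow> continuous_on UNIV d"
    "\<And>f e. continuous_on UNIV f \<Longrightarrow> 0 < e \<Longrightarrow> \<exists>d\<in>D. \<forall>x. \<bar>d x - f x\<bar> < e"
proof -
  have "\<exists>Z. finite Z \<and> (UNIV :: 'a set) \<subseteq> (\<Union>z\<in>Z. ball z (inverse (real (Suc N))))" for N
    using compact_eq_totally_bounded[of "UNIV :: 'a set"] K by (metis inverse_positive_iff_positive of_nat_0_less_iff zero_less_Suc)
  then obtain Z where Z: "\<And>N. finite (Z N)"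
    "\<And>N. (UNIV :: 'a set) \<subseteq> (\<Union>z\<in>Z N. ball z (inverse (real (Suc N))))" by metis
  define p :: "nat \<Rightarrow> 'a \<Rightarrow> 'a \<Rightarrow> real" where "p N z x = max 0 (inverse (real (Suc N)) - dist z x)" for N z x
  have p0: "p N z x \<ge> 0" for N z x by (simp add: p_def)
  have ppos: "(\<Sum>z\<in>Z N. p N z x) > 0" for N x
  proof -
    have "x \<in> (\<Union>z\<in>Z N. ball z (inverse (real (Suc N))))" using Z(2)[of N] by blast
    then obtain z where z: "z \<in> Z N" "dist z x < inverse (real (Suc N))" by auto
    show ?thesis by (rule sum_pos2[OF Z(1) z(1)]) (use z(2) p0 in \<open>auto simp: p_def\<close>)
  qed
  define F where "F N q x = (\<Sum>z\<in>Z N. q z * p N z x) / (\<Sum>z\<in>Z N. p N z x)" for N and q :: "'a \<Rightarrow> real" and x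
  define D where "D = (\<Union>N. F N ` (Z N \<rightarrow>\<^sub>E \<rat>))"
  show ?thesis
  proof
    show "countable D" unfolding D_def
      by (intro countable_UN countable_image countable_PiE Z countable_rat) auto
    have pc: "continuous_on UNIV (p N z)" for N z unfolding p_def by (intro continuous_intros)
    have "continuous_on UNIV (F N q)" for N q
      unfolding F_def
      by (intro continuous_intros pc) (use ppos in \<open>auto simp: less_imp_neq[symmetric]\<close>)
    then show "\<And>d. d \<in> D \<Longrightarrow> continuous_on UNIV d" by (auto simp: D_def)
    fix f :: "'a \<Rightarrow> real" and e :: real assume f: "continuous_on UNIV f" and e: "0 < e"
    have "e / 2 > 0" using e by simp
    then obtain d where d: "d > 0" "\<And>x y. dist y x < d \<Longrightarrow> \<bar>f y - f x\<bar> < e / 2"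
      using compact_uniformly_continuous[OF f K] UNIV_I
      unfolding uniformly_continuous_on_def dist_real_def by metis
    obtain N where N: "inverse (real (Suc N)) < d" using reals_Archimedean[OF d(1)] by auto
    have "\<exists>q\<in>\<rat>. \<bar>q - f z\<bar> < e / 2" for z
      using Rats_dense_in_real[of "f z" "f z + e / 2"] e by force
    then obtain q where q: "\<And>z. q z \<in> \<rat>" "\<And>z. \<bar>q z - f z\<bar> < e / 2" by metis
    define q' where "q' = restrict q (Z N)"
    have "q' \<in> Z N \<rightarrow>\<^sub>E \<rat>" using q(1) by (auto simp: q'_def)
    then have "F N q' \<in> D" unfolding D_def by blast
    moreover have "\<bar>F N q' x - f x\<bar> < e" for x
    proof -
      let ?S = "\<Sum>z\<in>Z N. p N z x"
      have "F N q' x - f x = (\<Sum>z\<in>Z N. (q z - f x) * p N z x) / ?S"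
        using ppos[of N x]
        by (simp add: F_def q'_def field_simps sum_subtractf sum_distrib_left sum_distrib_right)
      moreover have "\<bar>\<Sum>z\<in>Z N. (q z - f x) * p N z x\<bar> < e * ?S"
      proof -
        have le: "\<bar>(q z - f x) * p N z x\<bar> \<le> e * p N z x"
          and lt: "p N z x > 0 \<Longrightarrow> \<bar>(q z - f x) * p N z x\<bar> < e * p N z x" for z
        proof -
          show 1: "\<bar>(q z - f x) * p N z x\<bar> < e * p N z x" if "p N z x > 0"
          proof -
            have "dist z x < d" using that N by (auto simp: p_def max_def split: if_splits)
            then have "\<bar>q z - f x\<bar> < e" using d(2)[of z x] q(2)[of z] by linarith
            then show ?thesis using that by (simp add: abs_mult)
          qed
          show "\<bar>(q z - f x) * p N z x\<bar> \<le> e * p N z x"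
            using 1 p0[of N z x] by (cases "p N z x = 0") auto
        qed
        \<comment> \<open>The termwise bounds alone give only a weak inequality; one positive weight
          makes it strict.\<close>
        obtain z where z: "z \<in> Z N" "p N z x > 0"
          using ppos[of N x] p0 by (metis less_le sum.neutral)
        have "\<bar>\<Sum>z\<in>Z N. (q z - f x) * p N z x\<bar> \<le> (\<Sum>z\<in>Z N. \<bar>(q z - f x) * p N z x\<bar>)" by (rule sum_abs)
        also have "\<dots> < (\<Sum>z\<in>Z N. e * p N z x)"
          by (rule sum_strict_mono_ex1) (use Z(1) le lt[OF z(2)] z(1) in auto)
        finally show ?thesis by (simp add: sum_distrib_left)
      qed
      ultimately show ?thesis using ppos[of N x]
        by (simp only: abs_divide) (simp add: pos_divide_less_eq)
    qed
    ultimately show "\<exists>d\<in>D. \<forall>x. \<bar>d x - f x\<bar> < e" by blast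
  qed
qed

section \<open>Common zeros and dimension\<close>

text \<open>The opposite of an essential tuple, one all of whose small perturbations have a common
  zero on \<open>C\<close>. For compact \<open>C\<close> this is the classical description of
  dimension less than \<open>card I\<close> by unstable values.\<close>

definition avoidable :: "'i set \<Rightarrow> 'a::metric_space set \<Rightarrow> bool" where
  "avoidable I C \<longleftrightarrow>
     (\<forall>f :: 'i \<Rightarrow> 'a \<Rightarrow> real. \<forall>e>0. (\<forall>i\<in>I. continuous_on UNIV (f i)) \<longrightarrow>
        (\<exists>g. (\<forall>i\<in>I. continuous_on UNIV (g i) \<and> (\<forall>x. \<bar>g i x - f i x\<bar> < e)) \<and>
             (\<forall>x\<in>C. \<exists>i\<in>I. g i x \<noteq> 0)))"

text \<open>A Baire argument in the space of functions \<open>u\<close>: by density it suffices to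
  treat countably many tuples \<open>g\<close> and tolerances \<open>1 / (k + 1)\<close>, and each
  of them imposes an open dense condition \<open>W g k\<close> on \<open>u\<close>.\<close>

lemma avoidable_slice:
  fixes C :: "'a::metric_space set" and v :: "'a \<Rightarrow> real"
  assumes K: "compact (UNIV :: 'a set)" and C: "compact C"
    and J: "finite J" "i \<notin> J" and av: "avoidable (insert i J) C"
    and v: "continuous_on UNIV v" and r: "0 < r"
  obtains u where "continuous_on UNIV u" "\<And>x. \<bar>u x - v x\<bar> < r" "avoidable J {x \<in> C. u x = 0}"
proof -
  obtain D :: "('a \<Rightarrow> real) set" where D: "countable D" "\<And>d. d \<in> D \<Longrightarrow> continuous_on UNIV d"
    "\<And>f e. continuous_on UNIV f \<Longrightarrow> 0 < e \<Longrightarrow> \<exists>d\<in>D. \<forall>x. \<bar>d x - f x\<bar> < e"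
    using dense_countable_real_functions[OF K] by metis
  define W where "W g k = {u :: 'a \<Rightarrow>\<^sub>C real. \<exists>g'.
      (\<forall>j\<in>J. continuous_on UNIV (g' j) \<and> (\<forall>x. \<bar>g' j x - g j x\<bar> < inverse (real (Suc k)))) \<and>
      (\<forall>x\<in>C. apply_bcontfun u x = 0 \<longrightarrow> (\<exists>j\<in>J. g' j x \<noteq> 0))}" for g k
  define \<G> where "\<G> = (\<lambda>(g, k). W g k) ` ((J \<rightarrow>\<^sub>E D) \<times> UNIV)"
  have "countable \<G>" unfolding \<G>_def
    by (intro countable_image countable_SIGMA countable_PiE J D) auto
  moreover have "open T" if TG: "T \<in> \<G>" for T
  proof -
    obtain g k where T: "T = W g k" and "g \<in> J \<rightarrow>\<^sub>E D" using TG by (auto simp: \<G>_def)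
    show ?thesis unfolding T open_dist
    proof
      fix u assume "u \<in> W g k"
      then obtain g' where g': "\<forall>j\<in>J. continuous_on UNIV (g' j) \<and> (\<forall>x. \<bar>g' j x - g j x\<bar> < inverse (real (Suc k)))"
        and nz: "\<forall>x\<in>C. apply_bcontfun u x = 0 \<longrightarrow> (\<exists>j\<in>J. g' j x \<noteq> 0)" unfolding W_def by blast
      \<comment> \<open>\<open>q\<close> vanishes exactly at the common zeros of \<open>u\<close>
        and the \<open>g' j\<close>, so it has a positive lower bound \<eta> on \<open>C\<close>. A
        zero of some \<open>u'\<close> within \<eta> of \<open>u\<close> satisfies
        \<open>\<bar>u x\<bar> < \<eta>\<close>, hence some \<open>g' j x\<close> is non-zero: the
        same \<open>g'\<close> serves \<open>u'\<close>.\<close>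
      define q where "q x = \<bar>apply_bcontfun u x\<bar> + (\<Sum>j\<in>J. \<bar>g' j x\<bar>)" for x
      have qc: "continuous_on C q" unfolding q_def
        using g' by (intro continuous_intros) (auto intro: continuous_on_subset)
      have qpos: "q x > 0" if xC: "x \<in> C" for x
      proof (cases "apply_bcontfun u x = 0")
        case True
        then obtain j where "j \<in> J" "g' j x \<noteq> 0" using nz xC by auto
        then have "(\<Sum>j\<in>J. \<bar>g' j x\<bar>) > 0" by (intro sum_pos2[OF J(1)]) auto
        then show ?thesis by (simp add: q_def)
      next
        case False
        then show ?thesis unfolding q_def by (intro add_pos_nonneg sum_nonneg) auto
      qed
      obtain \<eta> where \<eta>: "\<eta> > 0" "\<And>x. x \<in> C \<Longrightarrow> \<eta> \<le> q x"
      proof (cases "C = {}")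
        case True then show ?thesis using that[of 1] by auto
      next
        case False
        then obtain x0 where "x0 \<in> C" "\<forall>y\<in>C. q x0 \<le> q y"
          using continuous_attains_inf[OF C _ qc] by auto
        then show ?thesis using that[of "q x0"] qpos by auto
      qed
      have "u' \<in> W g k" if "dist u' u < \<eta>" for u'
      proof -
        have "\<exists>j\<in>J. g' j x \<noteq> 0" if x: "x \<in> C" "apply_bcontfun u' x = 0" for x
        proof (rule ccontr)
          assume "\<not> ?thesis"
          then have "q x = \<bar>apply_bcontfun u x\<bar>" by (simp add: q_def)
          moreover have "\<bar>apply_bcontfun u x\<bar> < \<eta>"
            using dist_bounded[of u' x u] \<open>dist u' u < \<eta>\<close> x(2) by (auto simp: dist_real_def)
          ultimately show False using \<eta>(2)[OF x(1)] by linarith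
        qed
        then show ?thesis unfolding W_def using g' by blast
      qed
      then show "\<exists>e>0. \<forall>y. dist y u < e \<longrightarrow> y \<in> W g k" using \<eta>(1) by blast
    qed
  qed
  moreover have "closure T = UNIV" if TG: "T \<in> \<G>" for T
  proof -
    obtain g k where T: "T = W g k" and g: "g \<in> J \<rightarrow>\<^sub>E D" using TG by (auto simp: \<G>_def)
    have "\<exists>u\<in>W g k. dist u u0 < e" if e: "e > 0" for u0 e
    proof -
      \<comment> \<open>The tuple \<open>g\<close> is completed by \<open>u0\<close> at index
        \<open>i\<close> and then perturbed. The new component at \<open>i\<close> becomes
        \<open>u\<close>, the others witness \<open>u \<in> W g k\<close>; the tolerance has to
        serve both purposes.\<close>
      define e' where "e' = min (e / 2) (inverse (real (Suc k)))"
      have "e' > 0" using e by (auto simp: e'_def)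
      moreover have "\<forall>l\<in>insert i J. continuous_on UNIV ((g(i := apply_bcontfun u0)) l)"
        using g D(2) by (auto dest: PiE_mem)
      ultimately obtain g' where g': "\<forall>l\<in>insert i J. continuous_on UNIV (g' l) \<and> (\<forall>x. \<bar>g' l x - (g(i := apply_bcontfun u0)) l x\<bar> < e')"
        and nz: "\<forall>x\<in>C. \<exists>l\<in>insert i J. g' l x \<noteq> 0"
        using av unfolding avoidable_def by blast
      define u where "u = Bcontfun (g' i)"
      have u: "apply_bcontfun u = g' i" unfolding u_def
        by (rule bcontfun_of_compact[OF K]) (use g' in auto)
      have "dist (apply_bcontfun u x) (apply_bcontfun u0 x) \<le> e / 2" for x
        using g' unfolding u dist_real_def e'_def by (auto simp: less_imp_le)
      then have "dist u u0 \<le> e / 2" by (rule dist_bound)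
      then have "dist u u0 < e" using e by auto
      moreover have "u \<in> W g k"
      proof -
        have "\<forall>x\<in>C. apply_bcontfun u x = 0 \<longrightarrow> (\<exists>j\<in>J. g' j x \<noteq> 0)" using nz by (simp add: u)
        moreover have "\<forall>j\<in>J. continuous_on UNIV (g' j) \<and> (\<forall>x. \<bar>g' j x - g j x\<bar> < inverse (real (Suc k)))"
          using g' J(2) by (auto simp: e'_def split: if_splits)
        ultimately show ?thesis unfolding W_def by blast
      qed
      ultimately show ?thesis by blast
    qed
    then show ?thesis unfolding T dense_approx by blast
  qed
  ultimately have "closure (\<Inter>\<G>) = UNIV" by (rule Baire_dense_open)
  then obtain u where u: "u \<in> \<Inter>\<G>" "dist u (Bcontfun v) < r"
    unfolding dense_approx using r by blast
  show ?thesis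
  proof
    show "continuous_on UNIV (apply_bcontfun u)" by simp
    show "\<bar>apply_bcontfun u x - v x\<bar> < r" for x
      using dist_bounded[of u x "Bcontfun v"] u(2) unfolding bcontfun_of_compact[OF K v] dist_real_def by auto
    show "avoidable J {x \<in> C. apply_bcontfun u x = 0}"
      unfolding avoidable_def
    proof (intro allI impI)
      fix f :: "'b \<Rightarrow> 'a \<Rightarrow> real" and e :: real
      assume e: "0 < e" and f: "\<forall>i\<in>J. continuous_on UNIV (f i)"
      have "\<forall>j\<in>J. \<exists>d\<in>D. \<forall>x. \<bar>d x - f j x\<bar> < e / 2" using D(3) f half_gt_zero[OF e] by blast
      then obtain g0 where g0: "\<And>j. j \<in> J \<Longrightarrow> g0 j \<in> D \<and> (\<forall>x. \<bar>g0 j x - f j x\<bar> < e / 2)" by metis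
      define g where "g = restrict g0 J"
      obtain k where k: "inverse (real (Suc k)) < e / 2" using reals_Archimedean[of "e / 2"] e by auto
      have "g \<in> J \<rightarrow>\<^sub>E D" using g0 by (auto simp: g_def)
      then have "u \<in> W g k" using u(1) by (auto simp: \<G>_def)
      then obtain g' where g': "\<forall>j\<in>J. continuous_on UNIV (g' j) \<and> (\<forall>x. \<bar>g' j x - g j x\<bar> < inverse (real (Suc k)))"
        and nz: "\<forall>x\<in>C. apply_bcontfun u x = 0 \<longrightarrow> (\<exists>j\<in>J. g' j x \<noteq> 0)" unfolding W_def by blast
      have "\<bar>g' j x - f j x\<bar> < e" if "j \<in> J" for j x
      proof -
        have "\<bar>g' j x - g j x\<bar> < e / 2" using g' that k by (meson less_trans)
        moreover have "\<bar>g j x - f j x\<bar> < e / 2" using g0 that by (simp add: g_def)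
        ultimately show ?thesis by linarith
      qed
      then show "\<exists>g. (\<forall>i\<in>J. continuous_on UNIV (g i) \<and> (\<forall>x. \<bar>g i x - f i x\<bar> < e)) \<and>
             (\<forall>x\<in>{x \<in> C. apply_bcontfun u x = 0}. \<exists>i\<in>J. g i x \<noteq> 0)"
        using g' nz by (intro exI[of _ g']) auto
    qed
  qed
qed

text \<open>Induction on the number of functions. The sets \<open>{u < 0}\<close>, with
  \<open>u\<close> a generic function near \<open>dist a x - r / 2\<close>, are small neighbourhoods
  of \<open>a\<close> whose frontiers lie in \<open>{u = 0}\<close>, where one function fewer is
  avoidable.\<close>

lemma avoidable_imp_dim_le:
  fixes C :: "'a::metric_space set"
  assumes K: "compact (UNIV :: 'a set)"
  shows "finite I \<Longrightarrow> compact C \<Longrightarrow> avoidable I C \<Longrightarrow> top_of_set C dim_le (int (card I) - 1)"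
proof (induction I arbitrary: C rule: finite_induct)
  case empty
  \<comment> \<open>No index exists at which a function could be non-zero, so \<open>C\<close> has
    no points; this matches dimension -1.\<close>
  then have "C = {}" using gt_ex[of "0::real"] by (auto simp: avoidable_def)
  then show ?case by (simp add: dimension_le_eq_empty)
next
  case (insert i J)
  show ?case
  proof (rule dimension_le.intros)
    show "- 1 \<le> int (card (insert i J)) - 1" by simp
    fix V a assume V: "openin (top_of_set C) V" "a \<in> V"
    then obtain O' where O': "open O'" "V = C \<inter> O'" by (auto simp: openin_open)
    then obtain r where r: "r > 0" "ball a r \<subseteq> O'" using V openE[of O' a] by auto
    \<comment> \<open>An error below \<open>r / 2\<close> keeps \<open>u\<close> negative at
      \<open>a\<close>, while \<open>u x < 0\<close> still forces
      \<open>dist a x < r\<close>.\<close>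
    have "continuous_on UNIV (\<lambda>x. dist a x - r / 2)" by (intro continuous_intros)
    then obtain u where u: "continuous_on UNIV u" "\<And>x. \<bar>u x - (dist a x - r / 2)\<bar> < r / 2"
      "avoidable J {x \<in> C. u x = 0}"
      using avoidable_slice[OF K insert.prems(1) insert.hyps insert.prems(2), of "\<lambda>x. dist a x - r / 2" "r / 2"] r(1)
      half_gt_zero by blast
    define U where "U = C \<inter> u -` {..<0}"
    have cl: "closed {x \<in> C. u x = 0}"
      using continuous_closed_preimage_constant[of C u 0] u(1) compact_imp_closed[OF insert.prems(1)] continuous_on_subset by blast
    have "open (u -` {..<0})" using u(1) by (simp add: continuous_on_open_vimage open_vimage)
    then have op: "openin (top_of_set C) U" by (auto simp: U_def openin_open)
    have "closedin (top_of_set C) (C \<inter> u -` {..0})"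
      using u(1) by (auto simp: closedin_closed intro!: exI[of _ "u -` {..0}"] closed_vimage)
    then have "top_of_set C closure_of U \<subseteq> C \<inter> u -` {..0}"
      by (intro closure_of_minimal) (auto simp: U_def)
    then have fr: "top_of_set C frontier_of U \<subseteq> {x \<in> C. u x = 0}"
      using interior_of_openin[OF op] by (force simp: frontier_of_def U_def)
    have "top_of_set {x \<in> C. u x = 0} dim_le (int (card J) - 1)"
      by (rule insert.IH[OF _ u(3)]) (use compact_Int_closed[OF insert.prems(1) cl] in \<open>simp add: Int_def conj_ac\<close>)
    then have "subtopology (top_of_set {x \<in> C. u x = 0}) (top_of_set C frontier_of U) dim_le (int (card J) - 1)"
      by (rule dimension_le_subtopology)
    moreover have "subtopology (top_of_set {x \<in> C. u x = 0}) (top_of_set C frontier_of U)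
        = subtopology (top_of_set C) (top_of_set C frontier_of U)"
      using fr by (simp add: subtopology_subtopology Int_absorb1 subset_trans[of _ "{x \<in> C. u x = 0}" C])
    moreover have "u a < 0" using u(2)[of a, unfolded dist_self] by linarith
    then have "a \<in> U" using V(2) O' by (auto simp: U_def)
    moreover have "U \<subseteq> V"
    proof
      fix x assume x: "x \<in> U"
      then have "u x < 0" by (simp add: U_def)
      then have "dist a x < r" using u(2)[of x] by linarith
      then show "x \<in> V" using r(2) O'(2) x by (auto simp: U_def)
    qed
    ultimately show "\<exists>U. a \<in> U \<and> U \<subseteq> V \<and> openin (top_of_set C) U \<and>
        subtopology (top_of_set C) (top_of_set C frontier_of U) dim_le (int (card (insert i J)) - 1 - 1)"
      using op insert.hyps by (intro exI[of _ U]) simp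
  qed
qed

section \<open>Finite packings\<close>

lemma finite_positive_lower_bound:
  fixes f :: "'b \<Rightarrow> real"
  assumes "finite A" "\<And>a. a \<in> A \<Longrightarrow> 0 < f a"
  obtains \<eta> where "0 < \<eta>" "\<And>a. a \<in> A \<Longrightarrow> \<eta> \<le> f a"
proof (cases "A = {}")
  case True
  then show ?thesis using that[of 1] by auto
next
  case False
  then show ?thesis using that[of "Min (f ` A)"] assms by auto
qed

text \<open>Sums in \<open>ennreal\<close> are suprema of finite partial sums, and a subfamily of a
  packing is a packing.\<close>

lemma finite_packing_of_less:
  assumes "a < packing_delta h \<delta> A"
  obtains S where "S \<in> packings \<delta> A" "finite S" "a < (\<Sum>(x, r)\<in>S. ennreal (h r))"
proof -
  obtain S where S: "S \<in> packings \<delta> A" "a < (\<Sum>\<^sub>\<infinity>(x, r)\<in>S. ennreal (h r))"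
    using assms unfolding packing_delta_def less_SUP_iff by blast
  then obtain F where "finite F" "F \<subseteq> S" "a < (\<Sum>(x, r)\<in>F. ennreal (h r))"
    by (subst (asm) nonneg_infsum_complete) (auto simp: less_SUP_iff)
  moreover have "F \<in> packings \<delta> A"
    using S(1) \<open>F \<subseteq> S\<close> unfolding packings_def
    by (auto intro: countable_subset disjoint_family_on_mono)
  ultimately show ?thesis using that by blast
qed

text \<open>
  Compactness of the whole space lets one inflate the balls of a finite packing; this is what makes
  it possible to move their centres.
\<close>

lemma inflate_disjoint_cballs:
  fixes S :: "('a::metric_space \<times> real) set"
  assumes K: "compact (UNIV :: 'a set)" and "finite S"
    and disj: "disjoint_family_on (\<lambda>(x, r). cball x r) S"
  obtains \<eta> where "0 < \<eta>" "disjoint_family_on (\<lambda>(x, r). cball x (r + \<eta>)) S"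
proof -
  have "\<exists>\<eta>>0. cball (fst p) (snd p + \<eta>) \<inter> cball (fst q) (snd q + \<eta>) = {}"
    if pq: "p \<in> S" "q \<in> S" "p \<noteq> q" for p q
  proof -
    \<comment> \<open>\<open>\<phi> z \<le> 0\<close> says that \<open>z\<close> lies in both balls.
      Disjointness makes the minimum of \<phi> positive, and half of it is an admissible
      inflation.\<close>
    define \<phi> where "\<phi> z = max (dist (fst p) z - snd p) (dist (fst q) z - snd q)" for z
    have "continuous_on UNIV \<phi>" unfolding \<phi>_def by (intro continuous_intros)
    then obtain z0 where z0: "\<And>z. \<phi> z0 \<le> \<phi> z"
      using continuous_attains_inf[OF K, of \<phi>] by auto
    have "cball (fst p) (snd p) \<inter> cball (fst q) (snd q) = {}"
      using disj pq by (auto simp: disjoint_family_on_def case_prod_unfold)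
    then have "\<not> \<phi> z0 \<le> 0" by (auto simp: \<phi>_def)
    then have "\<phi> z0 > 0" by simp
    moreover have "cball (fst p) (snd p + \<phi> z0 / 2) \<inter> cball (fst q) (snd q + \<phi> z0 / 2) = {}"
    proof (intro equals0I)
      fix z assume "z \<in> cball (fst p) (snd p + \<phi> z0 / 2) \<inter> cball (fst q) (snd q + \<phi> z0 / 2)"
      then have "\<phi> z \<le> \<phi> z0 / 2" unfolding \<phi>_def[of z] by (intro max.boundedI) auto
      then show False using z0[of z] \<open>\<phi> z0 > 0\<close> by linarith
    qed
    ultimately show ?thesis using half_gt_zero by blast
  qed
  then obtain \<eta> where \<eta>: "\<And>p q. p \<in> S \<Longrightarrow> q \<in> S \<Longrightarrow> p \<noteq> q \<Longrightarrow> 0 < \<eta> p q \<and>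
      cball (fst p) (snd p + \<eta> p q) \<inter> cball (fst q) (snd q + \<eta> p q) = {}" by metis
  define P where "P = {pq \<in> S \<times> S. fst pq \<noteq> snd pq}"
  have "finite P" using \<open>finite S\<close> by (simp add: P_def)
  moreover have "0 < \<eta> (fst pq) (snd pq)" if "pq \<in> P" for pq
    using that \<eta>[of "fst pq" "snd pq"] by (auto simp: P_def)
  ultimately obtain e where e: "0 < e" "\<And>pq. pq \<in> P \<Longrightarrow> e \<le> \<eta> (fst pq) (snd pq)"
    using finite_positive_lower_bound[of P "\<lambda>pq. \<eta> (fst pq) (snd pq)"] by blast
  have "cball (fst p) (snd p + e) \<inter> cball (fst q) (snd q + e) = {}" if pq: "p \<in> S" "q \<in> S" "p \<noteq> q" for p q
  proof -
    have "e \<le> \<eta> p q" using e(2)[of "(p, q)"] pq by (auto simp: P_def)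
    then have "cball (fst p) (snd p + e) \<subseteq> cball (fst p) (snd p + \<eta> p q)"
      "cball (fst q) (snd q + e) \<subseteq> cball (fst q) (snd q + \<eta> p q)" by auto
    then show ?thesis using \<eta>[OF pq] by blast
  qed
  then show ?thesis using that[OF e(1)] by (auto simp: disjoint_family_on_def case_prod_unfold)
qed

text \<open>A ball whose centre moves by at most \<eta> stays inside the ball inflated by \<eta>, so
  the moved balls remain disjoint with unchanged radii.\<close>

lemma sum_le_packing_delta_of_moved_centres:
  fixes S :: "('a::metric_space \<times> real) set"
  assumes "finite S" and S: "S \<subseteq> UNIV \<times> {0..\<delta>}" and \<eta>: "0 \<le> \<eta>"
    and disj: "disjoint_family_on (\<lambda>(x, r). cball x (r + \<eta>)) S"
    and t: "\<And>p. p \<in> S \<Longrightarrow> t p \<in> A \<and> dist (fst p) (t p) \<le> \<eta>"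
  shows "(\<Sum>(x, r)\<in>S. ennreal (h r)) \<le> packing_delta h \<delta> A"
proof -
  define T where "T = (\<lambda>p. (t p, snd p)) ` S"
  have sub: "cball (t p) (snd p) \<subseteq> cball (fst p) (snd p + \<eta>)" if p: "p \<in> S" for p
  proof
    fix z assume "z \<in> cball (t p) (snd p)"
    then show "z \<in> cball (fst p) (snd p + \<eta>)"
      using t[OF p] dist_triangle[of "fst p" z "t p"] by auto
  qed
  have mem: "t p \<in> cball (t p) (snd p)" if "p \<in> S" for p using that S by auto
  have dj: "cball (t p) (snd p) \<inter> cball (t q) (snd q) = {}" if "p \<in> S" "q \<in> S" "p \<noteq> q" for p q
    using disj sub[OF that(1)] sub[OF that(2)] that by (fastforce simp: disjoint_family_on_def case_prod_unfold)
  \<comment> \<open>Needed to keep the sum: as radii are non-negative, each ball contains its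
    centre, and equal pairs would contradict disjointness.\<close>
  have inj: "inj_on (\<lambda>p. (t p, snd p)) S"
  proof (rule inj_onI)
    fix p q assume pq: "p \<in> S" "q \<in> S" "(t p, snd p) = (t q, snd q)"
    then show "p = q" using dj[OF pq(1,2)] mem[OF pq(1)] by auto
  qed
  have "disjoint_family_on (\<lambda>(x, r). cball x r) T"
  unfolding disjoint_family_on_def
  proof (intro ballI impI)
    fix u v assume "u \<in> T" "v \<in> T" "u \<noteq> v"
    then obtain p q where "p \<in> S" "q \<in> S" "p \<noteq> q" "u = (t p, snd p)" "v = (t q, snd q)"
      unfolding T_def by blast
    then show "(case u of (x, r) \<Rightarrow> cball x r) \<inter> (case v of (x, r) \<Rightarrow> cball x r) = {}"
      using dj[of p q] by simp
  qed
  moreover have "T \<subseteq> A \<times> {0..\<delta>}" using t S by (auto simp: T_def)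
  ultimately have "T \<in> packings \<delta> A"
    using \<open>finite S\<close> by (simp add: packings_def T_def countable_finite)
  have "(\<Sum>(x, r)\<in>S. ennreal (h r)) = (\<Sum>(x, r)\<in>T. ennreal (h r))"
    unfolding T_def by (subst sum.reindex[OF inj]) (simp add: case_prod_unfold)
  also have "\<dots> = (\<Sum>\<^sub>\<infinity>(x, r)\<in>T. ennreal (h r))"
    using \<open>finite S\<close> by (simp add: T_def)
  also have "\<dots> \<le> packing_delta h \<delta> A"
    unfolding packing_delta_def by (rule SUP_upper) fact
  finally show ?thesis .
qed

text \<open>A finite packing of the closure tolerates a slight inflation, so its centres can be
  moved into \<open>A\<close> without changing the sum.\<close>

lemma packing_premeasure_closure:
  fixes A :: "'a::metric_space set"
  assumes K: "compact (UNIV :: 'a set)"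
  shows "packing_premeasure h (closure A) = packing_premeasure h A"
proof (rule antisym)
  show "packing_premeasure h A \<le> packing_premeasure h (closure A)"
    by (rule packing_premeasure_mono[OF closure_subset])
  have "packing_delta h \<delta> (closure A) \<le> packing_delta h \<delta> A" for \<delta>
  proof (rule ccontr)
    assume "\<not> ?thesis"
    then obtain S where S: "S \<in> packings \<delta> (closure A)" "finite S"
      "packing_delta h \<delta> A < (\<Sum>(x, r)\<in>S. ennreal (h r))"
      using finite_packing_of_less by (metis not_le)
    then obtain \<eta> where \<eta>: "0 < \<eta>" "disjoint_family_on (\<lambda>(x, r). cball x (r + \<eta>)) S"
      using inflate_disjoint_cballs[OF K S(2)] by (auto simp: packings_def)
    have "\<exists>y\<in>A. dist (fst p) y \<le> \<eta>" if p: "p \<in> S" for p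
    proof -
      have "fst p \<in> closure A" using S(1) p by (auto simp: packings_def)
      then obtain y where "y \<in> A" "dist y (fst p) < \<eta>" using \<eta>(1) closure_approachable by blast
      then show ?thesis by (auto simp: dist_commute intro: less_imp_le)
    qed
    then obtain t where "\<And>p. p \<in> S \<Longrightarrow> t p \<in> A \<and> dist (fst p) (t p) \<le> \<eta>" by metis
    moreover have "S \<subseteq> UNIV \<times> {0..\<delta>}" using S(1) by (auto simp: packings_def)
    ultimately have "(\<Sum>(x, r)\<in>S. ennreal (h r)) \<le> packing_delta h \<delta> A"
      using S(2) \<eta> by (intro sum_le_packing_delta_of_moved_centres[of S \<delta> \<eta> t]) auto
    then show False using S(3) by simp
  qed
  then show "packing_premeasure h (closure A) \<le> packing_premeasure h A"
    unfolding packing_premeasure_eq_INF by (intro INF_mono) blast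
qed

lemma packing_measure_le_premeasure: "packing_measure h A \<le> packing_premeasure h A"
proof -
  define B where "B i = (if i = 0 then A else {})" for i :: nat
  have "packing_measure h A \<le> (\<Sum>i. packing_premeasure h (B i))"
    unfolding packing_measure_def by (rule INF_lower) (auto simp: B_def)
  also have "\<dots> = (\<Sum>i\<in>{0}. packing_premeasure h (B i))"
    by (rule suminf_finite) (auto simp: B_def packing_premeasure_def)
  finally show ?thesis by (simp add: B_def)
qed

text \<open>Otherwise every member of the cover splits into countably many sets of finite
  premeasure. By Baire's theorem the closure of one of these contains a non-empty relatively open
  part of \<open>F\<close>, and passing to the closure does not change the premeasure.\<close>

lemma infinite_packing_measure_in_countable_cover:
  fixes F :: "'a::metric_space set"
  assumes K: "compact (UNIV :: 'a set)" and F: "closed F" "F \<noteq> {}"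
    and big: "\<And>U. open U \<Longrightarrow> U \<inter> F \<noteq> {} \<Longrightarrow> packing_premeasure h (U \<inter> F) = \<infinity>"
    and \<A>: "countable \<A>" "F \<subseteq> \<Union>\<A>"
  shows "\<exists>A\<in>\<A>. packing_measure h A = \<infinity>"
proof (rule ccontr)
  assume "\<not> ?thesis"
  then have fin: "packing_measure h A < \<infinity>" if "A \<in> \<A>" for A using that by (simp add: less_top)
  have "\<exists>B. A = (\<Union>i::nat. B i) \<and> (\<forall>i. packing_premeasure h (B i) < \<infinity>)" if A: "A \<in> \<A>" for A
  proof -
    obtain B :: "nat \<Rightarrow> 'a set" where B: "A = (\<Union>i. B i)" "(\<Sum>i. packing_premeasure h (B i)) < \<infinity>"
      using fin[OF A] unfolding packing_measure_def INF_less_iff by blast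
    then have "packing_premeasure h (B i) < \<infinity>" for i
      using ennreal_suminf_lessD by (metis infinity_ennreal_def)
    then show ?thesis using B by blast
  qed
  then obtain B where B: "\<And>A. A \<in> \<A> \<Longrightarrow> A = (\<Union>i::nat. B A i)"
    "\<And>A i. A \<in> \<A> \<Longrightarrow> packing_premeasure h (B A i) < \<infinity>" by metis
  define \<G> where "\<G> = (\<lambda>(A, i). F \<inter> closure (B A i)) ` (\<A> \<times> UNIV)"
  have "compact F" using K F(1) compact_Int_closed by fastforce
  have "\<Union>\<G> = F"
  proof
    show "F \<subseteq> \<Union>\<G>"
    proof
      fix x assume x: "x \<in> F"
      then obtain A where A: "A \<in> \<A>" "x \<in> A" using \<A>(2) by blast
      then obtain i where "x \<in> B A i" using B(1) by blast
      then show "x \<in> \<Union>\<G>" using A x closure_subset unfolding \<G>_def by fastforce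
    qed
  qed (auto simp: \<G>_def)
  then have "top_of_set F interior_of \<Union>\<G> \<noteq> {}"
    using F(2) interior_of_topspace[of "top_of_set F"] by auto
  moreover have "compact_space (top_of_set F)" using \<open>compact F\<close> by (simp add: compact_space_subtopology)
  then have "locally_compact_space (top_of_set F) \<and> regular_space (top_of_set F)"
    using compact_imp_locally_compact_space metrizable_imp_regular_space metrizable_space_subtopology
      metrizable_space_euclidean by blast
  moreover have "countable \<G>" unfolding \<G>_def using \<A>(1) by auto
  moreover have "\<And>T. T \<in> \<G> \<Longrightarrow> closedin (top_of_set F) T" by (auto simp: \<G>_def closedin_closed)
  ultimately obtain T where "T \<in> \<G>" "top_of_set F interior_of T \<noteq> {}"
    using Baire_category_alt[of "top_of_set F" \<G>] by blast
  then obtain A i where A: "A \<in> \<A>" and ne: "top_of_set F interior_of (F \<inter> closure (B A i)) \<noteq> {}"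
    unfolding \<G>_def by auto
  obtain U where U: "open U" "top_of_set F interior_of (F \<inter> closure (B A i)) = F \<inter> U"
    using openin_interior_of[of "top_of_set F" "F \<inter> closure (B A i)"] unfolding openin_open by blast
  have "U \<inter> F \<subseteq> closure (B A i)"
    using U(2) interior_of_subset[of "top_of_set F" "F \<inter> closure (B A i)"] by blast
  then have "packing_premeasure h (U \<inter> F) \<le> packing_premeasure h (B A i)"
    using packing_premeasure_mono packing_premeasure_closure[OF K] by metis
  then show False using big[OF U(1)] U(2) ne B(2)[OF A, of i] by (auto simp: Int_commute top_unique)
qed

section \<open>Stable values\<close>

text \<open>
  The uniform neighbourhoods are taken among maps on the whole space; for compact spaces this is no
  restriction by Tietze's theorem, and it makes monotonicity in the set immediate.
\<close>

definition stable_value :: "('a::metric_space \<Rightarrow> 'b::metric_space) \<Rightarrow> 'a set \<Rightarrow> 'b \<Rightarrow> bool" where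
  "stable_value f A y \<longleftrightarrow>
     (\<exists>s>0. \<forall>g. continuous_on UNIV g \<longrightarrow> (\<forall>x\<in>A. dist (g x) (f x) < s) \<longrightarrow> y \<in> g ` A)"

lemma stable_value_mono: "stable_value f A y \<Longrightarrow> A \<subseteq> B \<Longrightarrow> stable_value f B y"
  unfolding stable_value_def by (meson image_mono subsetD)

lemma stable_value_in_image: "stable_value f A y \<Longrightarrow> continuous_on UNIV f \<Longrightarrow> y \<in> f ` A"
  unfolding stable_value_def by (metis dist_self)

lemma clamp_bounds:
  fixes R t :: real
  assumes "0 \<le> R"
  shows "\<bar>max (- R) (min R t)\<bar> \<le> R"
  using assms by (auto simp: max_def min_def)

text \<open>By the dimension bound some closed ball in \<open>U\<close> is not avoidable, which
  gives a tuple \<open>f\<close> whose \<epsilon>-perturbations all have common zeros there. \<psi>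
  is \<open>f\<close> rescaled and truncated; for \<open>y\<close> in \<open>cball 0 e\<close>, the
  difference \<open>g - y\<close> becomes a perturbation of \<open>f\<close>, and its zero is a
  preimage of \<open>y\<close>.\<close>

lemma stably_covering_map:
  fixes U :: "'a::metric_space set"
  assumes K: "compact (UNIV :: 'a set)" and U: "open U" "U \<noteq> {}" and e: "0 < e"
    and dim: "\<And>V :: 'a set. open V \<Longrightarrow> V \<noteq> {} \<Longrightarrow>
                  ereal (real CARD('n::finite)) \<le> small_ind_dim (top_of_set V)"
  obtains \<psi> :: "'a \<Rightarrow> real ^ 'n" where "continuous_on UNIV \<psi>"
    "\<And>x. norm (\<psi> x) \<le> 2 * e * real CARD('n)"
    "\<forall>g. continuous_on UNIV g \<longrightarrow> (\<forall>x\<in>U. norm (g x - \<psi> x) < e) \<longrightarrow> cball 0 e \<subseteq> g ` U"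
proof -
  obtain x0 where "x0 \<in> U" using U by blast
  then obtain r where r: "r > 0" "cball x0 r \<subseteq> U" using U open_contains_cball by blast
  let ?C = "cball x0 r"
  have "\<not> avoidable (UNIV :: 'n set) ?C"
  proof
    assume av: "avoidable (UNIV :: 'n set) ?C"
    have "compact ?C" using compact_Int_closed[OF K closed_cball] by simp
    then have "top_of_set ?C dim_le (int CARD('n) - 1)"
      using avoidable_imp_dim_le[OF K _ _ av] by simp
    then have "subtopology (top_of_set ?C) (ball x0 r) dim_le (int CARD('n) - 1)"
      by (rule dimension_le_subtopology)
    then have "top_of_set (ball x0 r) dim_le (int CARD('n) - 1)"
      by (simp add: subtopology_subtopology Int_absorb1 ball_subset_cball)
    then have "small_ind_dim (top_of_set (ball x0 r)) \<le> ereal (real_of_int (int CARD('n) - 1))"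
      by (simp only: small_ind_dim_le_iff)
    moreover have "ereal (real CARD('n)) \<le> small_ind_dim (top_of_set (ball x0 r))"
      using r(1) by (intro dim) auto
    ultimately have "ereal (real CARD('n)) \<le> ereal (real_of_int (int CARD('n) - 1))"
      by (rule order_trans[rotated])
    then show False by simp
  qed
  then obtain f :: "'n \<Rightarrow> 'a \<Rightarrow> real" and \<epsilon> where \<epsilon>: "\<epsilon> > 0" and f: "\<And>i. continuous_on UNIV (f i)"
    and zero: "\<And>g. (\<And>i. continuous_on UNIV (g i)) \<Longrightarrow> (\<And>i x. \<bar>g i x - f i x\<bar> < \<epsilon>) \<Longrightarrow> \<exists>x\<in>?C. \<forall>i. g i x = 0"
    unfolding avoidable_def by (auto; metis)
  \<comment> \<open>The closeness of \<open>g\<close> to \<psi> and the norm of \<open>y\<close>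
    contribute at most \<open>e\<close> each; \<open>l\<close> turns their sum \<open>2 * e\<close>
    into the perturbation \<open>\<epsilon> / 2\<close> of \<open>f\<close>.\<close>
  define l where "l = 4 * e / \<epsilon>"
  have l: "l > 0" using e \<epsilon> by (simp add: l_def)
  define \<psi> :: "'a \<Rightarrow> real ^ 'n" where "\<psi> x = (\<chi> i. max (- (2 * e)) (min (2 * e) (l * f i x)))" for x
  have \<psi>c: "continuous_on UNIV \<psi>" unfolding \<psi>_def
    by (intro continuous_intros f)
  show ?thesis
  proof
    show "continuous_on UNIV \<psi>" by fact
    show "norm (\<psi> x) \<le> 2 * e * real CARD('n)" for x
    proof -
      have "norm (\<psi> x) \<le> (\<Sum>i\<in>UNIV. \<bar>\<psi> x $ i\<bar>)" by (rule norm_le_l1_cart)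
      also have "\<dots> \<le> (\<Sum>i\<in>(UNIV :: 'n set). 2 * e)"
        by (rule sum_mono) (use clamp_bounds[of "2 * e"] e in \<open>simp add: \<psi>_def\<close>)
      finally show ?thesis by (simp add: mult_ac)
    qed
    show "\<forall>g. continuous_on UNIV g \<longrightarrow> (\<forall>x\<in>U. norm (g x - \<psi> x) < e) \<longrightarrow> cball 0 e \<subseteq> g ` U"
    proof (intro allI impI subsetI)
      fix g :: "'a \<Rightarrow> real ^ 'n" and y :: "real ^ 'n"
      assume g: "continuous_on UNIV g" and close: "\<forall>x\<in>U. norm (g x - \<psi> x) < e"
      assume y: "y \<in> cball 0 e"
      define d where "d i x = (g x $ i - y $ i - \<psi> x $ i) / l" for i x
      \<comment> \<open>\<open>g\<close> is close to \<psi> only on \<open>U\<close>. Truncating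
        \<open>d\<close> bounds the perturbation everywhere and changes nothing at points of
        \<open>U\<close>.\<close>
      define g' where "g' i x = f i x + max (- (\<epsilon> / 2)) (min (\<epsilon> / 2) (d i x))" for i x
      have "continuous_on UNIV (g' i)" for i unfolding g'_def d_def using l
        by (intro continuous_intros f g \<psi>c) auto
      moreover have "\<bar>g' i x - f i x\<bar> < \<epsilon>" for i x
        using clamp_bounds[of "\<epsilon> / 2" "d i x"] \<epsilon> unfolding g'_def by linarith
      ultimately obtain x where x: "x \<in> ?C" "\<And>i. g' i x = 0" using zero by blast
      have xU: "x \<in> U" using x r by auto
      have "g x $ i = y $ i" for i
      proof -
        have "\<bar>g x $ i - \<psi> x $ i\<bar> < e"
          using component_le_norm_cart[of "g x - \<psi> x" i] bspec[OF close xU] by simp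
        moreover have "\<bar>y $ i\<bar> \<le> e" using component_le_norm_cart[of y i] y by simp
        ultimately have lt: "\<bar>g x $ i - y $ i - \<psi> x $ i\<bar> < 2 * e" by linarith
        moreover have "2 * e = \<epsilon> / 2 * l" using \<epsilon> by (simp add: l_def)
        ultimately have "\<bar>d i x\<bar> < \<epsilon> / 2" using l unfolding d_def abs_divide
          by (simp add: pos_divide_less_eq)
        then have "g' i x = f i x + d i x" by (auto simp: g'_def)
        then have "l * f i x + l * d i x = 0" using x(2)[of i] by (metis distrib_left mult_zero_right)
        then have eq: "l * f i x + (g x $ i - y $ i - \<psi> x $ i) = 0" using l by (simp add: d_def)
        have \<psi>i: "\<psi> x $ i = max (- (2 * e)) (min (2 * e) (l * f i x))" by (simp add: \<psi>_def)
        \<comment> \<open>At the common zero \<open>l * f i x\<close> is smaller than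
          \<open>2 * e\<close> in absolute value, so the truncation in \<psi> is inactive
          there.\<close>
        show ?thesis
        proof (cases "\<bar>l * f i x\<bar> \<le> 2 * e")
          case True
          then have "\<psi> x $ i = l * f i x" unfolding \<psi>i by auto
          then show ?thesis using eq by simp
        next
          case False
          then show ?thesis using eq lt by linarith
        qed
      qed
      then have "g x = y" by (simp add: vec_eq_iff)
      then show "y \<in> g ` U" using xU by blast
    qed
  qed
qed

section \<open>Packings along fibres\<close>

text \<open>
  The factor \<open>2\<close> in front of \<open>\<eta>\<close> leaves room for replacing the centres of a packing by points of the
  fibre.
\<close>

definition fibre_spread :: "(real \<Rightarrow> real) \<Rightarrow> nat \<Rightarrow> ('a::metric_space \<Rightarrow> 'b::metric_space) \<Rightarrow> bool" where
  "fibre_spread h m f \<longleftrightarrow>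
     (\<exists>f0. continuous_on UNIV f0 \<and> (\<forall>x. dist (f0 x) (f x) < inverse (real (Suc m))) \<and>
       (\<forall>x. \<exists>S \<eta>. finite S \<and> 0 < \<eta> \<and> \<eta> \<le> inverse (real (Suc m)) \<and>
          S \<subseteq> ball x (inverse (real (Suc m))) \<times> {0..inverse (real (Suc m))} \<and>
          disjoint_family_on (\<lambda>(c, r). cball c (r + 2 * \<eta>)) S \<and>
          of_nat (Suc m) \<le> (\<Sum>(c, r)\<in>S. ennreal (h r)) \<and>
          (\<forall>p\<in>S. stable_value f (ball (fst p) \<eta>) (f0 x))))"

definition stable_fibre :: "('a::metric_space \<Rightarrow> 'b::metric_space) \<Rightarrow> 'b \<Rightarrow> 'a set" where
  "stable_fibre f y = {z. \<forall>\<rho>>0. stable_value f (ball z \<rho>) y}"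

lemma closed_stable_fibre: "closed (stable_fibre f y)"
proof -
  have "z \<in> stable_fibre f y" if z: "z \<in> closure (stable_fibre f y)" for z
    unfolding stable_fibre_def
  proof (intro CollectI allI impI)
    fix \<rho> :: real assume "0 < \<rho>"
    then obtain w where w: "w \<in> stable_fibre f y" "dist w z < \<rho> / 2"
      using z closure_approachable half_gt_zero by metis
    then have "stable_value f (ball w (\<rho> / 2)) y" using \<open>0 < \<rho>\<close> by (simp add: stable_fibre_def)
    moreover have "ball w (\<rho> / 2) \<subseteq> ball z \<rho>"
    proof
      fix x assume "x \<in> ball w (\<rho> / 2)"
      then show "x \<in> ball z \<rho>" using w(2) dist_triangle[of z x w] by (simp add: dist_commute)
    qed
    ultimately show "stable_value f (ball z \<rho>) y" by (rule stable_value_mono)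
  qed
  then show ?thesis by (meson closure_subset_eq subsetI)
qed

lemma stable_fibre_subset:
  assumes f: "continuous_on UNIV f"
  shows "stable_fibre f y \<subseteq> f -` {y}"
proof
  fix z assume z: "z \<in> stable_fibre f y"
  show "z \<in> f -` {y}"
  proof (rule ccontr)
    assume "z \<notin> f -` {y}"
    moreover have "open (f -` (- {y}))" using f by (intro open_vimage) auto
    ultimately obtain \<rho> where "\<rho> > 0" "ball z \<rho> \<subseteq> f -` (- {y})"
      using open_contains_ball by blast
    moreover have "y \<in> f ` ball z \<rho>"
      using z \<open>\<rho> > 0\<close> stable_value_in_image[OF _ f] by (simp add: stable_fibre_def)
    ultimately show False by auto
  qed
qed

text \<open>For large \<open>m\<close> the map \<open>f0\<close> supplied by
  \<open>fibre_spread\<close> is so close to \<open>f\<close> that it still attains \<open>y\<close>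
  on \<open>A\<close>. At such a point \<open>x\<close> the attached packing has
  \<open>f0 x = y\<close> as a stable value around all its centres.\<close>

lemma stable_value_near:
  fixes f :: "'a::metric_space \<Rightarrow> 'b::metric_space"
  assumes spread: "\<And>m. fibre_spread h m f" and st: "stable_value f A y" and r: "0 < r" "0 < M"
  obtains m S \<eta> x where "inverse (real (Suc m)) < r" "M \<le> real (Suc m)" "x \<in> A" "finite S" "0 < \<eta>" "\<eta> \<le> inverse (real (Suc m))"
    "S \<subseteq> ball x (inverse (real (Suc m))) \<times> {0..inverse (real (Suc m))}"
    "disjoint_family_on (\<lambda>(c, r). cball c (r + 2 * \<eta>)) S"
    "of_nat (Suc m) \<le> (\<Sum>(c, r)\<in>S. ennreal (h r))"
    "\<forall>p\<in>S. stable_value f (ball (fst p) \<eta>) y"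
proof -
  obtain s where s: "s > 0" "\<And>g. continuous_on UNIV g \<Longrightarrow> (\<And>x. x \<in> A \<Longrightarrow> dist (g x) (f x) < s) \<Longrightarrow> y \<in> g ` A"
    using st unfolding stable_value_def by blast
  have "0 < min (inverse M) (min r s)" using r s(1) by auto
  then obtain m where m: "inverse (real (Suc m)) < min (inverse M) (min r s)" using reals_Archimedean by blast
  then have "inverse (real (Suc m)) < inverse M" by simp
  then have M: "M \<le> real (Suc m)" using r(2) by (simp only: inverse_less_iff_less of_nat_0_less_iff zero_less_Suc)
  obtain f0 where f0: "continuous_on UNIV f0" "\<And>x. dist (f0 x) (f x) < inverse (real (Suc m))"
     and sp: "\<And>x. \<exists>S \<eta>. finite S \<and> 0 < \<eta> \<and> \<eta> \<le> inverse (real (Suc m)) \<and>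
          S \<subseteq> ball x (inverse (real (Suc m))) \<times> {0..inverse (real (Suc m))} \<and>
          disjoint_family_on (\<lambda>(c, r). cball c (r + 2 * \<eta>)) S \<and>
          of_nat (Suc m) \<le> (\<Sum>(c, r)\<in>S. ennreal (h r)) \<and>
          (\<forall>p\<in>S. stable_value f (ball (fst p) \<eta>) (f0 x))"
    using spread[of m] unfolding fibre_spread_def by blast
  have "dist (f0 x) (f x) < s" for x using f0(2)[of x] m by linarith
  then have "y \<in> f0 ` A" using s(2)[OF f0(1)] by blast
  then obtain x where x: "x \<in> A" "f0 x = y" by blast
  from sp[of x] obtain S \<eta> where "finite S" "0 < \<eta>" "\<eta> \<le> inverse (real (Suc m))"
    "S \<subseteq> ball x (inverse (real (Suc m))) \<times> {0..inverse (real (Suc m))}"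
    "disjoint_family_on (\<lambda>(c, r). cball c (r + 2 * \<eta>)) S"
    "of_nat (Suc m) \<le> (\<Sum>(c, r)\<in>S. ennreal (h r))"
    "\<forall>p\<in>S. stable_value f (ball (fst p) \<eta>) y" unfolding x(2) by blast
  then show ?thesis using that[OF _ M x(1)] m by simp
qed

text \<open>If the stable fibre stayed away from \<open>A\<close>, a compact neighbourhood
  \<open>T\<close> of \<open>A\<close> would be covered by balls on which \<open>y\<close> is not
  stable. Below the Lebesgue number \<open>l\<close> of this cover, \<open>y\<close> is nevertheless
  stable on some ball centred in \<open>T\<close>.\<close>

lemma stable_fibre_near:
  fixes f :: "'a::metric_space \<Rightarrow> 'b::metric_space"
  assumes K: "compact (UNIV :: 'a set)" and spread: "\<And>m. fibre_spread h m f"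
    and st: "stable_value f A y" and r: "0 < r"
  shows "\<exists>x\<in>A. \<exists>z\<in>stable_fibre f y. dist x z < r"
proof (rule ccontr)
  assume contra: "\<not> ?thesis"
  define T where "T = closure (\<Union>x\<in>A. ball x (r / 2))"
  have "compact T" using compact_Int_closed[OF K closed_closure] by (simp add: T_def)
  have "\<exists>\<rho>>0. \<not> stable_value f (ball z \<rho>) y" if z: "z \<in> T" for z
  proof -
    obtain w where "w \<in> (\<Union>x\<in>A. ball x (r / 2))" "dist w z < r / 2"
      using z r closure_approachable half_gt_zero unfolding T_def by metis
    then obtain x where "x \<in> A" "dist x w < r / 2" by auto
    then have "x \<in> A" "dist x z < r" using \<open>dist w z < r / 2\<close> dist_triangle[of x z w] by auto
    then have "z \<notin> stable_fibre f y" using contra by blast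
    then show ?thesis by (simp add: stable_fibre_def)
  qed
  then obtain \<rho> where \<rho>: "\<And>z. z \<in> T \<Longrightarrow> 0 < \<rho> z \<and> \<not> stable_value f (ball z (\<rho> z)) y" by metis
  have "T \<subseteq> \<Union>((\<lambda>z. ball z (\<rho> z)) ` T)" using \<rho> by force
  then obtain l where l: "0 < l" "\<And>z. z \<in> T \<Longrightarrow> \<exists>G\<in>(\<lambda>z. ball z (\<rho> z)) ` T. ball z l \<subseteq> G"
    using Heine_Borel_lemma[OF \<open>compact T\<close>] by (metis (no_types, lifting) imageE open_ball)
  have "0 < min l (r / 2)" using l(1) r by simp
  then obtain m S \<eta> x where m: "inverse (real (Suc m)) < min l (r / 2)" "1 \<le> real (Suc m)"
    "x \<in> A" "finite S" "0 < \<eta>" "\<eta> \<le> inverse (real (Suc m))"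
    "S \<subseteq> ball x (inverse (real (Suc m))) \<times> {0..inverse (real (Suc m))}"
    "disjoint_family_on (\<lambda>(c, r). cball c (r + 2 * \<eta>)) S"
    "of_nat (Suc m) \<le> (\<Sum>(c, r)\<in>S. ennreal (h r))"
    "\<forall>p\<in>S. stable_value f (ball (fst p) \<eta>) y"
    by (rule stable_value_near[OF spread st _ zero_less_one])
  have "S \<noteq> {}" using m(9) by auto
  then obtain p where p: "p \<in> S" by blast
  have "dist x (fst p) < inverse (real (Suc m))"
    using subsetD[OF m(7) p] by (simp add: mem_Times_iff del: of_nat_Suc)
  then have "fst p \<in> ball x (r / 2)" using m(1) by (simp del: of_nat_Suc)
  then have "fst p \<in> T" unfolding T_def by (intro subsetD[OF closure_subset] UN_I[OF m(3)])
  then obtain z where z: "z \<in> T" "ball (fst p) l \<subseteq> ball z (\<rho> z)" using l(2) by blast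
  have "ball (fst p) \<eta> \<subseteq> ball (fst p) l" using m(1,6) by (intro subset_ball) simp
  then have "stable_value f (ball z (\<rho> z)) y"
    using stable_value_mono[OF bspec[OF m(10) p]] z(2) by blast
  then show False using \<rho>[OF z(1)] by blast
qed

text \<open>Near a point of the fibre there are packings with arbitrarily small radii and large sums
  such that \<open>y\<close> is stable around each centre. Hence every centre can be moved into the
  stable fibre.\<close>

lemma packing_premeasure_stable_fibre:
  fixes f :: "'a::metric_space \<Rightarrow> 'b::metric_space"
  assumes K: "compact (UNIV :: 'a set)" and spread: "\<And>m. fibre_spread h m f"
    and U: "open U" "U \<inter> stable_fibre f y \<noteq> {}"
  shows "packing_premeasure h (U \<inter> stable_fibre f y) = \<infinity>"
proof -
  let ?F = "U \<inter> stable_fibre f y"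
  obtain z where z: "z \<in> U" "z \<in> stable_fibre f y" using U by blast
  obtain \<rho> where \<rho>: "\<rho> > 0" "ball z \<rho> \<subseteq> U" using openE[OF U(1) z(1)] by blast
  \<comment> \<open>The path from \<open>z\<close> over \<open>x\<close> and the old centre to the
    new centre \<open>t\<close> has length below
    \<open>\<rho> / 4 + \<rho> / 4 + 2 * \<eta>\<close>, with
    \<open>\<eta> < \<rho> / 4\<close>.\<close>
  have st: "stable_value f (ball z (\<rho> / 4)) y" using z(2) \<rho>(1) by (simp add: stable_fibre_def)
  have "of_nat M \<le> packing_delta h \<delta> ?F" if \<delta>: "\<delta> > 0" for \<delta> and M :: nat
  proof -
    have "0 < min \<delta> (\<rho> / 4)" "0 < real (Suc M)" using \<delta> \<rho> by auto
    then obtain m S \<eta> x where m: "inverse (real (Suc m)) < min \<delta> (\<rho> / 4)" "real (Suc M) \<le> real (Suc m)"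
      "x \<in> ball z (\<rho> / 4)" "finite S" "0 < \<eta>" "\<eta> \<le> inverse (real (Suc m))"
      "S \<subseteq> ball x (inverse (real (Suc m))) \<times> {0..inverse (real (Suc m))}"
      "disjoint_family_on (\<lambda>(c, r). cball c (r + 2 * \<eta>)) S"
      "of_nat (Suc m) \<le> (\<Sum>(c, r)\<in>S. ennreal (h r))"
      "\<forall>p\<in>S. stable_value f (ball (fst p) \<eta>) y"
      by (rule stable_value_near[OF spread st])
    have "\<exists>t. t \<in> ?F \<and> dist (fst p) t \<le> 2 * \<eta>" if p: "p \<in> S" for p
    proof -
      \<comment> \<open>One \<eta> leads to a point \<open>w\<close> of the ball on which
        \<open>y\<close> is stable, the second from \<open>w\<close> to the stable fibre.\<close>
      obtain w t where wt: "dist (fst p) w < \<eta>" "t \<in> stable_fibre f y" "dist w t < \<eta>"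
        using stable_fibre_near[OF K spread bspec[OF m(10) p] m(5)] by auto
      then have "dist (fst p) t < 2 * \<eta>" using dist_triangle[of "fst p" t w] by linarith
      moreover have "dist x (fst p) < \<rho> / 4"
        using subsetD[OF m(7) p] m(1) by (simp add: mem_Times_iff del: of_nat_Suc)
      moreover have "\<eta> < \<rho> / 4" using m(1,6) by linarith
      moreover have "dist z x < \<rho> / 4" using m(3) by simp
      ultimately have "dist z t < \<rho>"
        using dist_triangle[of z t x] dist_triangle[of x t "fst p"] by linarith
      then show ?thesis using \<rho>(2) wt(2) \<open>dist (fst p) t < 2 * \<eta>\<close> by (intro exI[of _ t]) auto
    qed
    then obtain t where t: "\<And>p. p \<in> S \<Longrightarrow> t p \<in> ?F \<and> dist (fst p) (t p) \<le> 2 * \<eta>" by metis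
    have "(\<Sum>(c, r)\<in>S. ennreal (h r)) \<le> packing_delta h \<delta> ?F"
    proof (rule sum_le_packing_delta_of_moved_centres[OF m(4) _ _ m(8) t])
      show "S \<subseteq> UNIV \<times> {0..\<delta>}"
      proof
        fix p assume "p \<in> S"
        then show "p \<in> UNIV \<times> {0..\<delta>}"
          using subsetD[OF m(7)] m(1) by (fastforce simp: mem_Times_iff simp del: of_nat_Suc)
      qed
    qed (use m(5) in auto)
    moreover have "(of_nat M :: ennreal) \<le> of_nat (Suc m)" using m(2) by (simp only: of_nat_le_iff)
    ultimately show ?thesis using m(9) by (meson order_trans)
  qed
  then have "packing_delta h \<delta> ?F = \<infinity>" if "\<delta> > 0" for \<delta>
    using that ennreal_Ex_less_of_nat[of "packing_delta h \<delta> ?F"]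
    by (metis infinity_ennreal_def less_top not_le)
  then show ?thesis unfolding packing_premeasure_eq_INF by (simp add: top_unique INF_eq_const)
qed

section \<open>Perturbations with large packings in the fibres\<close>

text \<open>The bumps equal 1 within \<eta> of their centres and vanish from distance
  \<open>2 * \<eta>\<close> on. Separation by \<open>4 * \<eta>\<close> leaves at most one non-zero
  summand at each point, so the bound \<open>B\<close> is not multiplied.\<close>

lemma glue_on_separated_balls:
  fixes v :: "'a::metric_space \<Rightarrow> 'a \<Rightarrow> 'b::real_normed_vector"
  assumes C: "finite C" and \<eta>: "0 < \<eta>" and B: "0 \<le> B"
    and sep: "\<And>c c'. c \<in> C \<Longrightarrow> c' \<in> C \<Longrightarrow> c \<noteq> c' \<Longrightarrow> 4 * \<eta> \<le> dist c c'"
    and v: "\<And>c. c \<in> C \<Longrightarrow> continuous_on UNIV (v c)"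
      "\<And>c x. c \<in> C \<Longrightarrow> dist c x < 2 * \<eta> \<Longrightarrow> norm (v c x) \<le> B"
  obtains w where "continuous_on UNIV w" "\<And>x. norm (w x) \<le> B"
    "\<And>c x. c \<in> C \<Longrightarrow> dist c x < \<eta> \<Longrightarrow> w x = v c x"
proof -
  define bump where "bump c x = max 0 (min 1 (2 - dist c x / \<eta>))" for c x :: 'a
  define w where "w x = (\<Sum>c\<in>C. bump c x *\<^sub>R v c x)" for x
  have out: "bump c x = 0" if "2 * \<eta> \<le> dist c x" for c x
    using that \<eta> by (auto simp: bump_def field_simps)
  have single: "w x = bump c x *\<^sub>R v c x" if c: "c \<in> C" "dist c x < 2 * \<eta>" for c x
  proof -
    have "bump c' x = 0" if c': "c' \<in> C - {c}" for c'
    proof (rule out)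
      show "2 * \<eta> \<le> dist c' x"
        using sep[of c c'] c c' dist_triangle[of c c' x] by (auto simp: dist_commute)
    qed
    then show ?thesis unfolding w_def using sum.remove[OF C c(1), of "\<lambda>c. bump c x *\<^sub>R v c x"] by simp
  qed
  show ?thesis
  proof
    show "continuous_on UNIV w" unfolding w_def bump_def using \<eta> v(1)
      by (intro continuous_intros) auto
    show "norm (w x) \<le> B" for x
    proof (cases "\<exists>c\<in>C. dist c x < 2 * \<eta>")
      case True
      then obtain c where c: "c \<in> C" "dist c x < 2 * \<eta>" by blast
      have "\<bar>bump c x\<bar> \<le> 1" by (simp add: bump_def)
      then have "norm (w x) \<le> 1 * B"
        unfolding single[OF c] norm_scaleR using v(2)[OF c] B by (intro mult_mono) auto
      then show ?thesis by simp
    next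
      case False
      then have "w x = 0" unfolding w_def by (intro sum.neutral) (use out in \<open>auto simp: not_less\<close>)
      then show ?thesis using B by simp
    qed
    show "w x = v c x" if c: "c \<in> C" "dist c x < \<eta>" for c x
    proof -
      have "bump c x = 1" using c(2) \<eta> by (simp add: bump_def field_simps)
      then show ?thesis using single[of c x] c \<eta> by simp
    qed
  qed
qed

text \<open>Finitely many packings, one near each point of a net, serve all \<open>x\<close>. Around
  each centre \<open>c\<close> the map is replaced by \<open>f0 c + \<psi> c\<close>, whose small
  perturbations cover \<open>cball (f0 c) e\<close>; by uniform continuity this ball contains
  \<open>f0 x\<close> for all \<open>x\<close> near \<open>c\<close>.\<close>

lemma fibre_spread_perturbation:
  fixes f0 :: "'a::metric_space \<Rightarrow> real ^ 'n::finite"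
  assumes K: "compact (UNIV :: 'a set)"
    and dim: "\<And>U :: 'a set. open U \<Longrightarrow> U \<noteq> {} \<Longrightarrow>
                  ereal (real CARD('n)) \<le> small_ind_dim (top_of_set U)"
    and pack: "\<And>U :: 'a set. open U \<Longrightarrow> U \<noteq> {} \<Longrightarrow> packing_premeasure h U = \<infinity>"
    and f0: "continuous_on UNIV f0" and \<epsilon>: "0 < \<epsilon>"
  obtains f' s where "continuous_on UNIV f'" "0 < s" "\<And>x. dist (f' x) (f0 x) \<le> \<epsilon>"
    "\<And>f. (\<And>x. dist (f x) (f' x) < s) \<Longrightarrow> fibre_spread h m f"
proof -
  define \<mu> where "\<mu> = inverse (real (Suc m))"
  define n where "n = real CARD('n)"
  \<comment> \<open>The change of \<open>f0\<close> is at most \<open>e\<close> from its oscillation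
    plus \<open>2 * e * n\<close> from \<psi>. The cap \<open>\<mu> / 2\<close> leaves room for the
    further distance \<open>e / 2\<close> from \<open>f'\<close> to \<open>f\<close>.\<close>
  define e where "e = min \<epsilon> (\<mu> / 2) / (2 * n + 1)"
  have \<mu>: "\<mu> > 0" by (simp add: \<mu>_def)
  have n: "n > 0" by (simp add: n_def)
  have e: "e > 0" using \<epsilon> \<mu> n by (simp add: e_def)
  have en: "e * (2 * n + 1) = min \<epsilon> (\<mu> / 2)" using n by (simp add: e_def)
  have "0 < e * n" using e n by simp
  then have e\<mu>: "e \<le> \<mu> / 2" using en by (simp add: algebra_simps)
  obtain d0 where d0: "0 < d0" "\<And>x y. dist x y < d0 \<Longrightarrow> dist (f0 x) (f0 y) < e"
    using compact_uniformly_continuous[OF f0 K] e UNIV_I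
    unfolding uniformly_continuous_on_def by metis
  \<comment> \<open>Net point and packing centre each cost \<delta>, so every centre used for
    \<open>x\<close> is within \<open>2 * \<delta>\<close> of \<open>x\<close>.\<close>
  define \<delta> where "\<delta> = min d0 \<mu> / 2"
  have \<delta>: "\<delta> > 0" "2 * \<delta> \<le> d0" "2 * \<delta> \<le> \<mu>" using d0(1) \<mu> by (auto simp: \<delta>_def)
  obtain Z where Z: "finite Z" "(UNIV :: 'a set) \<subseteq> (\<Union>z\<in>Z. ball z \<delta>)"
    using compact_eq_totally_bounded[of "UNIV :: 'a set"] K \<delta>(1) by meson
  define Q where "Q z S \<eta> \<longleftrightarrow> finite S \<and> S \<subseteq> ball z \<delta> \<times> {0..\<mu>} \<and> of_nat (Suc m) \<le> (\<Sum>(c, r)\<in>S. ennreal (h r)) \<and>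
      0 < \<eta> \<and> disjoint_family_on (\<lambda>(c, r). cball c (r + \<eta>)) S" for z :: 'a and S and \<eta> :: real
  have "\<exists>S \<eta>. Q z S \<eta>" for z
  proof -
    have "packing_premeasure h (ball z \<delta>) = \<infinity>" using \<delta>(1) by (intro pack) auto
    moreover have "packing_premeasure h (ball z \<delta>) \<le> packing_delta h \<mu> (ball z \<delta>)"
      unfolding packing_premeasure_eq_INF using \<mu> by (intro INF_lower) auto
    ultimately have "of_nat (Suc m) < packing_delta h \<mu> (ball z \<delta>)"
      using of_nat_less_top[of "Suc m"] by (auto simp: top_unique)
    then obtain S where S: "S \<in> packings \<mu> (ball z \<delta>)" "finite S"
      "of_nat (Suc m) < (\<Sum>(c, r)\<in>S. ennreal (h r))"
      by (rule finite_packing_of_less)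
    then have sub: "S \<subseteq> ball z \<delta> \<times> {0..\<mu>}" and "disjoint_family_on (\<lambda>(c, r). cball c r) S"
      by (simp_all add: packings_def)
    then obtain \<eta> where "0 < \<eta>" "disjoint_family_on (\<lambda>(c, r). cball c (r + \<eta>)) S"
      using inflate_disjoint_cballs[OF K S(2)] by blast
    then show ?thesis using sub S(2) less_imp_le[OF S(3)] unfolding Q_def by (intro exI[of _ S] exI[of _ \<eta>] conjI)
  qed
  then obtain S \<eta>0 where "\<And>z. Q z (S z) (\<eta>0 z)" by metis
  then have S: "\<And>z. finite (S z)" "\<And>z. S z \<subseteq> ball z \<delta> \<times> {0..\<mu>}"
    "\<And>z. of_nat (Suc m) \<le> (\<Sum>(c, r)\<in>S z. ennreal (h r))"
    and \<eta>0: "\<And>z. 0 < \<eta>0 z" "\<And>z. disjoint_family_on (\<lambda>(c, r). cball c (r + \<eta>0 z)) (S z)"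
    unfolding Q_def by simp_all
  \<comment> \<open>Packings at different net points may overlap or share centres, as only one of
    them is used for a given \<open>x\<close>. The gluing merely needs distinct centres to be
    separated.\<close>
  define C where "C = (\<Union>z\<in>Z. fst ` S z)"
  have C: "finite C" using Z(1) S(1) by (simp add: C_def)
  obtain \<eta>1 where \<eta>1: "0 < \<eta>1" "\<And>z. z \<in> Z \<Longrightarrow> \<eta>1 \<le> \<eta>0 z"
    using finite_positive_lower_bound[of Z \<eta>0] Z(1) \<eta>0(1) by blast
  define P where "P = {p \<in> C \<times> C. fst p \<noteq> snd p}"
  have P: "finite P" "\<And>p. p \<in> P \<Longrightarrow> 0 < dist (fst p) (snd p)" using C by (auto simp: P_def)
  then obtain \<eta>2 where \<eta>2: "0 < \<eta>2" "\<And>p. p \<in> P \<Longrightarrow> \<eta>2 \<le> dist (fst p) (snd p)"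
    using finite_positive_lower_bound[of P "\<lambda>p. dist (fst p) (snd p)"] by blast
  \<comment> \<open>In turn: disjointness after inflation by \<open>2 * \<eta>\<close>, separation
    of centres by \<open>4 * \<eta>\<close>, the bound \<mu> in \<open>fibre_spread\<close>, and
    oscillation of \<open>f0\<close> below \<open>e\<close> on the balls of radius
    \<open>2 * \<eta>\<close>.\<close>
  define \<eta> where "\<eta> = min (min (\<eta>1 / 2) (\<eta>2 / 4)) (min \<mu> \<delta>)"
  have \<eta>: "0 < \<eta>" "2 * \<eta> \<le> \<eta>1" "4 * \<eta> \<le> \<eta>2" "\<eta> \<le> \<mu>" "\<eta> \<le> \<delta>"
    using \<eta>1 \<eta>2 \<mu> \<delta> by (auto simp: \<eta>_def)
  have sep: "4 * \<eta> \<le> dist c c'" if "c \<in> C" "c' \<in> C" "c \<noteq> c'" for c c'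
    using \<eta>2(2)[of "(c, c')"] \<eta>(3) that by (auto simp: P_def)
  have "\<exists>\<psi> :: 'a \<Rightarrow> real ^ 'n. continuous_on UNIV \<psi> \<and> (\<forall>x. norm (\<psi> x) \<le> 2 * e * n) \<and>
      (\<forall>g. continuous_on UNIV g \<longrightarrow> (\<forall>x\<in>ball c \<eta>. norm (g x - \<psi> x) < e) \<longrightarrow> cball 0 e \<subseteq> g ` ball c \<eta>)" for c :: 'a
  proof -
    have ne: "ball c \<eta> \<noteq> {}" using \<eta>(1) by auto
    show ?thesis unfolding n_def
      by (rule stably_covering_map[OF K open_ball ne e dim]) blast+
  qed
  then obtain \<psi> :: "'a \<Rightarrow> 'a \<Rightarrow> real ^ 'n" where \<psi>: "\<And>c. continuous_on UNIV (\<psi> c)"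
    "\<And>c x. norm (\<psi> c x) \<le> 2 * e * n"
    "\<And>c g. continuous_on UNIV g \<Longrightarrow> (\<forall>x\<in>ball c \<eta>. norm (g x - \<psi> c x) < e) \<Longrightarrow> cball 0 e \<subseteq> g ` ball c \<eta>"
    by metis
  define v where "v c x = f0 c + \<psi> c x - f0 x" for c x
  have vc: "continuous_on UNIV (v c)" for c unfolding v_def by (intro continuous_intros \<psi> f0)
  have vb: "norm (v c x) \<le> e * (2 * n + 1)" if "dist c x < 2 * \<eta>" for c x
  proof -
    have "dist c x < d0" using that \<eta>(5) \<delta>(2) by linarith
    then have "norm (f0 c - f0 x) < e" using d0(2) by (simp add: dist_norm)
    moreover have "norm (v c x) \<le> norm (f0 c - f0 x) + norm (\<psi> c x)"
      unfolding v_def using norm_triangle_ineq[of "f0 c - f0 x" "\<psi> c x"] by (simp add: algebra_simps)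
    ultimately show ?thesis using \<psi>(2)[of c x] by (simp add: algebra_simps)
  qed
  have nonneg: "0 \<le> e * (2 * n + 1)" using e n by simp
  have "\<exists>w. continuous_on UNIV w \<and> (\<forall>x. norm (w x) \<le> e * (2 * n + 1)) \<and>
      (\<forall>c\<in>C. \<forall>x. dist c x < \<eta> \<longrightarrow> w x = v c x)"
    by (rule glue_on_separated_balls[OF C \<eta>(1) nonneg, of v]) (use sep vc vb in blast)+
  then obtain w where w: "continuous_on UNIV w" "\<And>x. norm (w x) \<le> e * (2 * n + 1)"
    "\<And>c x. c \<in> C \<Longrightarrow> dist c x < \<eta> \<Longrightarrow> w x = v c x"
    by blast
  define f' where "f' x = f0 x + w x" for x
  have near: "dist (f' x) (f0 x) \<le> min \<epsilon> (\<mu> / 2)" for x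
    using w(2)[of x] unfolding en f'_def dist_norm by simp
  show ?thesis
  proof
    show "continuous_on UNIV f'" unfolding f'_def by (intro continuous_intros f0 w)
    \<comment> \<open>Half of \<open>e\<close> is spent between \<open>f'\<close> and
      \<open>f\<close>, the other half on the margin for the stability of values of
      \<open>f\<close>.\<close>
    show "0 < e / 2" using e by simp
    show "dist (f' x) (f0 x) \<le> \<epsilon>" for x using near[of x] by simp
    fix f :: "'a \<Rightarrow> real ^ 'n" assume f: "\<And>x. dist (f x) (f' x) < e / 2"
    have stable: "stable_value f (ball c \<eta>) (f0 x)" if c: "c \<in> C" "dist c x < d0" for c x
      unfolding stable_value_def
    proof (intro exI conjI allI impI)
      show "0 < e / 2" using e by simp
      fix g :: "'a \<Rightarrow> real ^ 'n"
      assume g: "continuous_on UNIV g" "\<forall>x\<in>ball c \<eta>. dist (g x) (f x) < e / 2"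
      have "norm (g z - f0 c - \<psi> c z) < e" if z: "z \<in> ball c \<eta>" for z
      proof -
        have "f' z = f0 c + \<psi> c z" using w(3)[OF c(1), of z] z by (simp add: f'_def v_def)
        moreover have "dist (g z) (f' z) < e"
          using dist_triangle[of "g z" "f' z" "f z"] f[of z] bspec[OF g(2) z] by linarith
        ultimately show ?thesis by (simp add: dist_norm diff_diff_eq)
      qed
      then have "cball 0 e \<subseteq> (\<lambda>z. g z - f0 c) ` ball c \<eta>"
        using g(1) by (intro \<psi>(3)) (auto intro!: continuous_intros)
      moreover have "f0 x - f0 c \<in> cball 0 e" using d0(2)[OF c(2)] by (simp add: dist_norm norm_minus_commute)
      ultimately obtain z where "z \<in> ball c \<eta>" "f0 x - f0 c = g z - f0 c" by blast
      then show "f0 x \<in> g ` ball c \<eta>" by auto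
    qed
    show "fibre_spread h m f"
      unfolding fibre_spread_def \<mu>_def[symmetric]
    proof (intro exI[of _ f0] conjI allI f0)
      fix x
      show "dist (f0 x) (f x) < \<mu>"
        using near[of x] f[of x] e\<mu> \<mu> dist_triangle[of "f0 x" "f x" "f' x"] by (simp add: dist_commute)
      obtain z where z: "z \<in> Z" "dist z x < \<delta>" using Z(2) by fastforce
      have close: "fst p \<in> C \<and> dist x (fst p) < 2 * \<delta>" if p: "p \<in> S z" for p
      proof -
        have "dist z (fst p) < \<delta>" using subsetD[OF S(2) p] by (simp add: mem_Times_iff)
        then show ?thesis using z p dist_triangle[of x "fst p" z] by (auto simp: C_def dist_commute)
      qed
      show "\<exists>S \<eta>. finite S \<and> 0 < \<eta> \<and> \<eta> \<le> \<mu> \<and> S \<subseteq> ball x \<mu> \<times> {0..\<mu>} \<and>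
          disjoint_family_on (\<lambda>(c, r). cball c (r + 2 * \<eta>)) S \<and>
          of_nat (Suc m) \<le> (\<Sum>(c, r)\<in>S. ennreal (h r)) \<and>
          (\<forall>p\<in>S. stable_value f (ball (fst p) \<eta>) (f0 x))"
      proof (intro exI[of _ "S z"] exI[of _ \<eta>] conjI ballI S \<eta>)
        show "S z \<subseteq> ball x \<mu> \<times> {0..\<mu>}"
        proof
          fix p assume p: "p \<in> S z"
          then show "p \<in> ball x \<mu> \<times> {0..\<mu>}"
            using subsetD[OF S(2) p] close[OF p] \<delta>(3) by (simp add: mem_Times_iff)
        qed
        have "2 * \<eta> \<le> \<eta>0 z" using \<eta>(2) \<eta>1(2)[OF z(1)] by simp
        then have "cball c (r + 2 * \<eta>) \<subseteq> cball c (r + \<eta>0 z)" for c :: 'a and r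
          by (intro subset_cball) simp
        then show "disjoint_family_on (\<lambda>(c, r). cball c (r + 2 * \<eta>)) (S z)"
          using \<eta>0(2)[of z] unfolding disjoint_family_on_def case_prod_unfold by blast
        fix p assume p: "p \<in> S z"
        show "stable_value f (ball (fst p) \<eta>) (f0 x)"
          using close[OF p] \<delta>(2) by (intro stable) (auto simp: dist_commute)
      qed
    qed
  qed
qed

section \<open>Genericity\<close>

lemma nowhere_dense_frontier:
  assumes "closed S"
  shows "nowhere_dense (frontier S)"
proof -
  have "interior (frontier S) \<subseteq> interior S"
    using assms by (intro interior_mono) (simp add: frontier_subset_closed)
  moreover have "interior (frontier S) \<inter> interior S = {}"
    using interior_subset[of "frontier S"] by (auto simp: frontier_def)
  ultimately show ?thesis by (auto simp: nowhere_dense_def)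
qed

lemma nowhere_dense_complement_dense_interior:
  assumes "closure (interior S) = UNIV"
  shows "nowhere_dense (- S)"
  using assms by (simp add: nowhere_dense_def closure_complement interior_complement)

lemma comeager_if_countable:
  assumes "countable \<N>" "\<And>N. N \<in> \<N> \<Longrightarrow> nowhere_dense N" "- S \<subseteq> \<Union>\<N>"
  shows "comeager S"
proof (cases "\<N> = {}")
  case True
  then show ?thesis using assms(3)
    unfolding comeager_def meager_def by (intro exI[of _ "\<lambda>_. {}"]) (auto simp: nowhere_dense_def)
next
  case False
  \<comment> \<open>\<open>meager\<close> asks for equality with the union, so the covering sets are
    cut down to the complement of \<open>S\<close>.\<close>
  define N where "N i = from_nat_into \<N> i - S" for i
  have "nowhere_dense (N i)" for i
  proof -
    have "interior (closure (N i)) \<subseteq> interior (closure (from_nat_into \<N> i))"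
      unfolding N_def by (intro interior_mono closure_mono) auto
    then show ?thesis using assms(2)[OF from_nat_into[OF False, of i]] by (auto simp: nowhere_dense_def)
  qed
  moreover have "- S = (\<Union>i. N i)"
    using assms(3) range_from_nat_into[OF False assms(1)] by (fastforce simp: N_def)
  ultimately show ?thesis unfolding comeager_def meager_def by blast
qed

text \<open>Maps close to \<open>f\<close> that attain \<open>y\<close> force values of
  \<open>f\<close> close to \<open>y\<close>, and the range of \<open>f\<close> is compact.\<close>

lemma closed_range_covers:
  fixes V :: "'b::metric_space set"
  assumes K: "compact (UNIV :: 'a::metric_space set)"
  shows "closed {f :: 'a \<Rightarrow>\<^sub>C 'b. V \<subseteq> range (apply_bcontfun f)}"
proof -
  have "V \<subseteq> range (apply_bcontfun f)"
    if f: "f \<in> closure {f :: 'a \<Rightarrow>\<^sub>C 'b. V \<subseteq> range (apply_bcontfun f)}" for f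
  proof
    fix y assume y: "y \<in> V"
    have "closed (range (apply_bcontfun f))"
      using compact_continuous_image[OF continuous_on_apply_bcontfun K] compact_imp_closed by blast
    moreover have "y \<in> closure (range (apply_bcontfun f))"
      unfolding closure_approachable
    proof (intro allI impI)
      fix e :: real assume "0 < e"
      then obtain g where g: "V \<subseteq> range (apply_bcontfun g)" "dist g f < e"
        using f unfolding closure_approachable by blast
      then obtain x where "y = apply_bcontfun g x" using y by blast
      then show "\<exists>z\<in>range (apply_bcontfun f). dist z y < e"
        using dist_fun_lt_imp_dist_val_lt[OF g(2), of x] by (auto simp: dist_commute)
    qed
    ultimately show "y \<in> range (apply_bcontfun f)" by simp
  qed
  then show ?thesis by (metis (no_types, lifting) closure_subset_eq mem_Collect_eq subsetI)
qed

lemma stable_value_of_interior: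
  fixes f :: "'a::metric_space \<Rightarrow>\<^sub>C 'b::metric_space"
  assumes K: "compact (UNIV :: 'a set)"
    and f: "f \<in> interior {f. V \<subseteq> range (apply_bcontfun f)}" and y: "y \<in> V"
  shows "stable_value (apply_bcontfun f) UNIV y"
proof -
  obtain s where s: "s > 0" "ball f s \<subseteq> {f. V \<subseteq> range (apply_bcontfun f)}"
    using f mem_interior by blast
  \<comment> \<open>Strict pointwise bounds give only a weak bound on the supremum;
    \<open>s / 2\<close> keeps it below \<open>s\<close>.\<close>
  have "y \<in> range g" if g: "continuous_on UNIV g" "\<forall>x\<in>UNIV. dist (g x) (apply_bcontfun f x) < s / 2" for g
  proof -
    have "dist (apply_bcontfun f x) (apply_bcontfun (Bcontfun g) x) \<le> s / 2" for x
      using g(2) unfolding bcontfun_of_compact[OF K g(1)] by (simp add: dist_commute less_imp_le)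
    then have "dist f (Bcontfun g) \<le> s / 2" by (rule dist_bound)
    then have "Bcontfun g \<in> ball f s" using s(1) by simp
    then have "V \<subseteq> range (apply_bcontfun (Bcontfun g))" using s(2) by blast
    then show ?thesis using y bcontfun_of_compact[OF K g(1)] by auto
  qed
  then show ?thesis unfolding stable_value_def using s(1) half_gt_zero by blast
qed

text \<open>The stable fibre is a non-empty closed subset of the fibre, so any countable cover of
  the fibre has a member of infinite packing measure. The one-set cover gives the first claim;
  sigma-finiteness would supply a cover contradicting this.\<close>

lemma fibre_over_stable_value:
  fixes f :: "'a::metric_space \<Rightarrow> 'b::metric_space"
  assumes K: "compact (UNIV :: 'a set)" and f: "continuous_on UNIV f"
    and spread: "\<And>m. fibre_spread h m f" and st: "stable_value f UNIV y"
  shows "packing_measure h (f -` {y}) = \<infinity>"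
    and "\<not> sigma_finite_measure (packing_measure_on h (f -` {y}))"
proof -
  let ?E = "f -` {y}"
  have ne: "stable_fibre f y \<noteq> {}" using stable_fibre_near[OF K spread st zero_less_one] by blast
  have inf: "\<exists>A\<in>\<A>. packing_measure h A = \<infinity>" if "countable \<A>" "?E \<subseteq> \<Union>\<A>" for \<A>
    using infinite_packing_measure_in_countable_cover[OF K closed_stable_fibre ne
        packing_premeasure_stable_fibre[OF K spread] that(1)] that(2) stable_fibre_subset[OF f] by blast
  show "packing_measure h ?E = \<infinity>" using inf[of "{?E}"] by simp
  show "\<not> sigma_finite_measure (packing_measure_on h ?E)"
  proof
    assume "sigma_finite_measure (packing_measure_on h ?E)"
    then obtain \<A> where \<A>: "countable \<A>" "\<A> \<subseteq> sets (packing_measure_on h ?E)"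
      "\<Union>\<A> = space (packing_measure_on h ?E)" "\<forall>A\<in>\<A>. emeasure (packing_measure_on h ?E) A \<noteq> \<infinity>"
      unfolding sigma_finite_measure_def by blast
    then obtain A where "A \<in> \<A>" "packing_measure h A = \<infinity>"
      using inf[of \<A>] by (auto simp: space_packing_measure_on)
    then show False using \<A>(2,4) emeasure_packing_measure_on by (metis subsetD)
  qed
qed

theorem theorem4p12:
  fixes h :: "real \<Rightarrow> real"
  assumes gauge: "gauge_function h"
    and left_cont: "\<And>r. r > 0 \<Longrightarrow> continuous (at_left r) h"
    and compact_K: "compact (UNIV :: 'a::metric_space set)"
    and dim_K: "\<And>U :: 'a set. open U \<Longrightarrow> U \<noteq> {} \<Longrightarrow>
                  ereal (real CARD('n::finite)) \<le> small_ind_dim (top_of_set U)"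
    and packing_K: "\<And>U :: 'a set. open U \<Longrightarrow> U \<noteq> {} \<Longrightarrow> packing_measure h U = \<infinity>"
  shows "comeager {f :: 'a \<Rightarrow>\<^sub>C (real ^ 'n).
           \<forall>y \<in> interior (range (apply_bcontfun f)).
             packing_measure h (apply_bcontfun f -` {y}) = \<infinity> \<and>
             \<not> sigma_finite_measure (packing_measure_on h (apply_bcontfun f -` {y}))}"
proof -
  obtain \<B> :: "(real ^ 'n) set set" where \<B>: "countable \<B>" "topological_basis \<B>"
    using ex_countable_basis by blast
  define G where "G m = {f :: 'a \<Rightarrow>\<^sub>C (real ^ 'n). fibre_spread h m (apply_bcontfun f)}" for m
  define R where "R V = {f :: 'a \<Rightarrow>\<^sub>C (real ^ 'n). V \<subseteq> range (apply_bcontfun f)}" for V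
  have pre: "packing_premeasure h U = \<infinity>" if "open U" "U \<noteq> {}" for U :: "'a set"
    using packing_K[OF that] packing_measure_le_premeasure[of h U] by (simp add: top_unique)
  have "nowhere_dense (- G m)" for m
  proof (rule nowhere_dense_complement_dense_interior)
    have "\<exists>g\<in>interior (G m). dist g f < e" if e: "e > 0" for f e
    proof -
      obtain f' s where f': "continuous_on UNIV f'" "0 < s" "\<And>x. dist (f' x) (apply_bcontfun f x) \<le> e / 2"
        "\<And>f. (\<And>x. dist (f x) (f' x) < s) \<Longrightarrow> fibre_spread h m f"
        using fibre_spread_perturbation[OF compact_K dim_K pre, of "apply_bcontfun f" "e / 2" m]
          continuous_on_apply_bcontfun half_gt_zero[OF e] by metis
      define g where "g = Bcontfun f'"
      have g: "apply_bcontfun g = f'" unfolding g_def by (rule bcontfun_of_compact[OF compact_K f'(1)])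
      have "dist g f \<le> e / 2" using f'(3) by (intro dist_bound) (simp add: g)
      moreover have "ball g s \<subseteq> G m"
      proof
        fix k assume "k \<in> ball g s"
        then have "dist k g < s" by (simp add: dist_commute)
        then have "dist (apply_bcontfun k x) (f' x) < s" for x
          using dist_fun_lt_imp_dist_val_lt[of k g s x] by (simp add: g)
        then show "k \<in> G m" unfolding G_def using f'(4) by blast
      qed
      then have "g \<in> interior (G m)" using f'(2) mem_interior by blast
      ultimately show ?thesis using e by (intro bexI[of _ g]) auto
    qed
    then show "closure (interior (G m)) = UNIV" unfolding dense_approx by blast
  qed
  moreover have "nowhere_dense (frontier (R V))" for V
    unfolding R_def by (rule nowhere_dense_frontier[OF closed_range_covers[OF compact_K]])
  ultimately show ?thesis
  proof (intro comeager_if_countable[of "range (\<lambda>m. - G m) \<union> (\<lambda>V. frontier (R V)) ` \<B>"])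
    show "- {f :: 'a \<Rightarrow>\<^sub>C (real ^ 'n). \<forall>y \<in> interior (range (apply_bcontfun f)).
             packing_measure h (apply_bcontfun f -` {y}) = \<infinity> \<and>
             \<not> sigma_finite_measure (packing_measure_on h (apply_bcontfun f -` {y}))}
        \<subseteq> \<Union>(range (\<lambda>m. - G m) \<union> (\<lambda>V. frontier (R V)) ` \<B>)"
    proof (rule ccontr)
      assume "\<not> ?thesis"
      then obtain f and y where fG: "\<And>m. f \<in> G m" and fR: "\<And>V. V \<in> \<B> \<Longrightarrow> f \<notin> frontier (R V)"
        and y: "y \<in> interior (range (apply_bcontfun f))"
        and bad: "\<not> (packing_measure h (apply_bcontfun f -` {y}) = \<infinity> \<and>
             \<not> sigma_finite_measure (packing_measure_on h (apply_bcontfun f -` {y})))"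
        by blast
      obtain V where V: "V \<in> \<B>" "y \<in> V" "V \<subseteq> interior (range (apply_bcontfun f))"
        using topological_basisE[OF \<B>(2) open_interior y] by blast
      \<comment> \<open>Membership in \<open>R V\<close> without being on its frontier means
        interior membership, which is the stability of all points of \<open>V\<close>. A countable
        base reduces this to countably many frontiers.\<close>
      then have "f \<in> R V" using interior_subset unfolding R_def by blast
      then have "f \<in> interior (R V)" using fR[OF V(1)] closure_subset unfolding frontier_def by blast
      then have "stable_value (apply_bcontfun f) UNIV y"
        unfolding R_def by (rule stable_value_of_interior[OF compact_K _ V(2)])
      then show False
        using fibre_over_stable_value[OF compact_K continuous_on_apply_bcontfun] fG bad
        unfolding G_def by blast
    qed
  qed (use \<B>(1) in auto)
qed

end
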